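(* For each $k\ge 1$ let $p_{0k},p_{1k}\ge 0$ with $p_{0k}+p_{1k}=1$, and let $\psi_1,\psi_2,\dots$ be independent random variables such that $\psi_k$ takes the value $0$ with probability $p_{0k}$ and the value $1$ with probability $p_{1k}$. For $\lambda\in(0,1)$ let $\psi=\sum_{k=1}^{\infty}\psi_k\lambda^k$. If there exists a number $p\in[\tfrac13,\tfrac23]$ such that $$\sum_{k=1}^{\infty}\left(p-p_{0k}\right)^2<\infty,$$ then for almost all $\lambda\in[p^p(1-p)^{1-p},1)$ (with respect to Lebesgue measure) the random variable $\psi$ has an absolutely continuous distribution.
   Context: A random variable has an absolutely continuous distribution if its distribution is absolutely continuous with respect to Lebesgue measure on $\mathbb{R}$. *)

theory Defs
  imports "HOL-Probability.Probability"
begin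

definition has_abs_cont_distribution :: "'a measure \<Rightarrow> ('a \<Rightarrow> real) \<Rightarrow> bool" where
  "has_abs_cont_distribution M X \<longleftrightarrow>
     X \<in> borel_measurable M \<and> absolutely_continuous lborel (distr M borel X)"

(* The series runs over k >= 1. It converges at every point where all values psi k (k >= 1)
   lie in {0, 1}; elsewhere the suminf convention applies, which only matters on a null set
   when each psi k is almost surely in {0, 1}. *)
definition random_power_series :: "(nat \<Rightarrow> 'a \<Rightarrow> real) \<Rightarrow> real \<Rightarrow> 'a \<Rightarrow> real" where
  "random_power_series \<psi> l \<omega> = (\<Sum>k. \<psi> (Suc k) \<omega> * l ^ Suc k)"

end

theory Submission
  imports Defs
begin

text \<open>
  Write \<open>T = p powr p * (1 - p) powr (1 - p)\<close>. Almost surely the cylinder of the first \<open>n\<close> digits of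
  an outcome has probability at most \<open>\<rho> ^ n\<close> for large \<open>n\<close>, for each \<open>\<rho> > T\<close>. Restricted to outcomes
  for which this holds from a fixed index on, the law of the series has a square integrable density for
  almost all \<open>l > \<rho>\<close> in any interval on which the differences of two series satisfy a transversality
  condition: a power series with coefficients in \<open>{-1, 0, 1}\<close> takes values in \<open>[-r, r]\<close> only on a set of
  parameters of measure \<open>O(r)\<close> (relative to its leading term), which bounds the mean over \<open>l\<close> of the
  correlation integral.

  With all digits, transversality holds only for \<open>l\<close> up to about \<open>0.649\<close>. Deleting digits in a
  periodic pattern of density \<open>\<delta>\<close> raises the threshold to \<open>T powr \<delta>\<close> but extends the
  transversality interval; the deleted digits are an independent summand, which preserves absolute
  continuity. Keeping only exponents divisible by \<open>2 ^ n\<close> replaces \<open>l\<close> by \<open>l ^ 2 ^ n\<close>, so it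
  suffices to cover \<open>(T, sqrt T]\<close>. The bound \<open>T ^ 3 \<le> 4 / 27\<close>, equivalent to \<open>p \<in> [1/3, 2/3]\<close>,
  makes four patterns suffice.
\<close>

section \<open>Transversality of lacunary series\<close>

text \<open>Cauchy's mean value theorem for \<open>t powr (d - K)\<close> against
  \<open>t powr (-K)\<close>: the quotient of the derivatives is
  \<open>(K - d) / K * c powr d\<close> with \<open>c < v\<close>. Measuring every term by the same
  difference lets a whole series be compared with its leading term.\<close>

lemma abs_powr_diff_le:
  fixes x y v d K :: real
  assumes "0 < x" "x < y" "y \<le> v" "0 < K" "0 \<le> d"
  shows "\<bar>x powr (d - K) - y powr (d - K)\<bar> \<le> \<bar>d - K\<bar> * v powr d / K * (x powr (-K) - y powr (-K))"
proof -
  have "\<exists>c. x < c \<and> c < y \<and>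
      (y powr (d - K) - x powr (d - K)) * ((-K) * c powr (-K - 1)) =
      (y powr (-K) - x powr (-K)) * ((d - K) * c powr (d - K - 1))"
    using assms by (intro GMVT') (auto intro!: derivative_eq_intros continuous_intros)
  then obtain c where c: "x < c" "c < y" and
    eq: "(y powr (d - K) - x powr (d - K)) * ((-K) * c powr (-K - 1)) =
      (y powr (-K) - x powr (-K)) * ((d - K) * c powr (d - K - 1))"
    by blast
  have c0: "0 < c" using c assms by simp
  have "c powr (d - K - 1) = c powr d * c powr (-K - 1)"
    by (simp add: algebra_simps flip: powr_add)
  then have "((y powr (d - K) - x powr (d - K)) * (-K)) * c powr (-K - 1)
      = ((y powr (-K) - x powr (-K)) * (d - K) * c powr d) * c powr (-K - 1)"
    using eq by (simp add: mult_ac)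
  then have "(x powr (d - K) - y powr (d - K)) * K = (y powr (-K) - x powr (-K)) * (d - K) * c powr d"
    unfolding mult_cancel_right using c0 by (auto simp: algebra_simps)
  then have "\<bar>(x powr (d - K) - y powr (d - K)) * K\<bar> = \<bar>(y powr (-K) - x powr (-K)) * (d - K) * c powr d\<bar>"
    by (rule arg_cong)
  then have e: "\<bar>x powr (d - K) - y powr (d - K)\<bar> * K = \<bar>y powr (-K) - x powr (-K)\<bar> * \<bar>d - K\<bar> * c powr d"
    using assms unfolding abs_mult by simp
  have m: "y powr (-K) \<le> x powr (-K)"
    using assms by (intro powr_mono2') auto
  have "c powr d \<le> v powr d"
    using c c0 assms by (intro powr_mono2) auto
  then have "\<bar>x powr (d - K) - y powr (d - K)\<bar> * K \<le> (x powr (-K) - y powr (-K)) * \<bar>d - K\<bar> * v powr d"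
    using e m by (auto intro!: mult_left_mono)
  then show ?thesis
    using assms by (simp add: field_simps)
qed

lemma powr_minus_diff_ge:
  fixes x y K :: real
  assumes "0 < x" "x < y" "y \<le> 1" "0 < K"
  shows "K * (y - x) \<le> x powr (-K) - y powr (-K)"
proof -
  have "\<exists>z. z > x \<and> z < y \<and> y powr (-K) - x powr (-K) = (y - x) * (- K * z powr (-K - 1))"
    using assms by (intro MVT2) (auto intro!: derivative_eq_intros)
  then obtain z where z: "x < z" "z < y" "y powr (-K) - x powr (-K) = (y - x) * (- K * z powr (-K - 1))"
    by blast
  have "1 powr (-K - 1) \<le> z powr (-K - 1)"
    using z assms by (intro powr_mono2') auto
  then have "K * (y - x) * 1 \<le> K * (y - x) * z powr (-K - 1)"
    using z assms by (intro mult_left_mono) auto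
  then show ?thesis using z by (simp add: algebra_simps)
qed

lemma summable_lacunary:
  fixes c :: "nat \<Rightarrow> real" and a :: "nat \<Rightarrow> nat" and l :: real
  assumes "strict_mono a" "\<And>i. \<bar>c i\<bar> \<le> 1" "0 \<le> l" "l < 1"
  shows "summable (\<lambda>i. c i * l ^ a i)"
proof (rule summable_comparison_test')
  show "summable (\<lambda>i. l ^ i)" using assms by (intro summable_geometric) auto
  fix i :: nat assume "0 \<le> i"
  have "l ^ a i \<le> l ^ i"
    using assms by (intro power_decreasing) (auto simp: seq_suble)
  moreover have "\<bar>c i\<bar> * l ^ a i \<le> 1 * l ^ a i"
    using assms by (intro mult_right_mono) auto
  ultimately show "norm (c i * l ^ a i) \<le> l ^ i"
    using assms by (simp add: abs_mult)
qed

text \<open>Quantitative transversality: the hypothesis on the gaps says that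
  \<open>x powr (-K) * g x\<close>, with \<open>g\<close> the series divided by its leading term, is strictly monotone.
  Differences are estimated termwise with Cauchy's mean value theorem.\<close>

lemma lacunary_series_transversality:
  fixes c :: "nat \<Rightarrow> real" and a :: "nat \<Rightarrow> nat" and u v K \<eta> r x y :: real
  assumes a: "strict_mono a" and uv: "0 < u" "u \<le> x" "x < y" "y \<le> v" "v < 1" and K: "0 < K" "0 < \<eta>"
    and c: "\<And>i. i < n \<Longrightarrow> c i = 0" "\<bar>c n\<bar> = 1" "\<And>i. \<bar>c i\<bar> \<le> 1"
    and sm: "summable (\<lambda>t. \<bar>real (a (n + 1 + t) - a n) - K\<bar> * v ^ (a (n + 1 + t) - a n))"
    and le: "(\<Sum>t. \<bar>real (a (n + 1 + t) - a n) - K\<bar> * v ^ (a (n + 1 + t) - a n)) \<le> K - \<eta>"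
    and r: "\<bar>\<Sum>i. c i * x ^ a i\<bar> \<le> r" "\<bar>\<Sum>i. c i * y ^ a i\<bar> \<le> r"
  shows "y - x \<le> 2 * r / (\<eta> * u ^ a n * u powr K)"
proof -
  define d where "d t = a (n + 1 + t) - a n" for t
  have d: "a (n + 1 + t) = a n + d t" for t
    unfolding d_def using strict_mono_leD[OF a, of n "n + 1 + t"] by simp
  \<comment> \<open>Divided by \<open>l ^ a n\<close> alone, the leading term would be constant. The
    extra exponent \<open>K\<close> turns it into \<open>c n * l powr (-K)\<close>, which varies at
    a definite rate, at the price of the factors \<open>\<bar>d t - K\<bar>\<close> in the
    tail.\<close>
  define f where "f l = (\<Sum>i. c i * l ^ a i) * l powr (- (real (a n) + K))" for l
  have f: "(\<lambda>t. c (n + 1 + t) * l powr (real (d t) - K)) sums (f l - c n * l powr (-K))"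
    if l: "0 < l" "l < 1" for l
  proof -
    have s: "summable (\<lambda>i. c i * l ^ a i)"
      using l by (intro summable_lacunary a c) auto
    have "(\<lambda>t. c (t + (n + 1)) * l ^ a (t + (n + 1))) sums ((\<Sum>i. c i * l ^ a i) - (\<Sum>i<n + 1. c i * l ^ a i))" (is "_ sums (_ - ?S)")
      using s by (intro sums_split_initial_segment summable_sums)
    moreover have "?S = c n * l ^ a n"
      using c(1) by simp
    ultimately have "(\<lambda>t. c (n + 1 + t) * l ^ a (n + 1 + t) * l powr (- (real (a n) + K))) sums
        (((\<Sum>i. c i * l ^ a i) - c n * l ^ a n) * l powr (- (real (a n) + K)))"
      by (intro sums_mult2) (simp add: add_ac)
    moreover have "l ^ a (n + 1 + t) * l powr (- (real (a n) + K)) = l powr (real (d t) - K)" for t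
      unfolding d using l by (simp add: powr_realpow[symmetric] flip: powr_add)
    moreover have "l ^ a n * l powr (- (real (a n) + K)) = l powr (-K)"
      using l by (simp add: powr_realpow[symmetric] flip: powr_add)
    ultimately show ?thesis
      by (simp add: f_def algebra_simps)
  qed
  define D where "D = x powr (-K) - y powr (-K)"
  have xy: "0 < x" "x < 1" "0 < y" "y < 1" using uv by auto
  have D: "K * (y - x) \<le> D"
    unfolding D_def using uv K by (intro powr_minus_diff_ge) auto
  have D0: "0 \<le> D"
    using D K uv by (meson diff_ge_0_iff_ge less_imp_le mult_nonneg_nonneg order_trans)
  have "(\<lambda>t. c (n + 1 + t) * x powr (real (d t) - K) - c (n + 1 + t) * y powr (real (d t) - K)) sums
     ((f x - c n * x powr (-K)) - (f y - c n * y powr (-K)))"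
    by (intro sums_diff f xy)
  then have s1: "(\<lambda>t. c (n + 1 + t) * (x powr (real (d t) - K) - y powr (real (d t) - K))) sums
     (f x - f y - c n * D)"
    by (simp add: D_def algebra_simps)
  have s2: "(\<lambda>t. \<bar>real (d t) - K\<bar> * v ^ d t * (D / K)) sums
     ((\<Sum>t. \<bar>real (d t) - K\<bar> * v ^ d t) * (D / K))"
    using sm unfolding d_def by (intro sums_mult2 summable_sums)
  have b: "\<bar>c (n + 1 + t) * (x powr (real (d t) - K) - y powr (real (d t) - K))\<bar>
      \<le> \<bar>real (d t) - K\<bar> * v ^ d t * (D / K)" for t
  proof -
    have "\<bar>c (n + 1 + t)\<bar> * \<bar>x powr (real (d t) - K) - y powr (real (d t) - K)\<bar>
        \<le> 1 * (\<bar>real (d t) - K\<bar> * v powr real (d t) / K * D)"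
      unfolding D_def using uv K c by (intro mult_mono abs_powr_diff_le) auto
    then show ?thesis using uv by (simp add: abs_mult powr_realpow)
  qed
  \<comment> \<open>The tail varies by at most \<open>(1 - \<eta> / K) * D\<close>, so it cannot
    cancel the variation \<open>D\<close> of the leading term; the remaining share
    \<open>\<eta> / K * D\<close> is at most
    \<open>\<bar>f x\<bar> + \<bar>f y\<bar>\<close>.\<close>
  have "\<bar>f x - f y - c n * D\<bar> \<le> (\<Sum>t. \<bar>real (d t) - K\<bar> * v ^ d t) * (D / K)"
    unfolding sums_unique[OF s1] sums_unique[OF s2]
    using b sums_summable[OF s2] by (intro norm_suminf_le[where 'a = real, unfolded real_norm_def])
  also have "\<dots> \<le> (K - \<eta>) * (D / K)"
    using le D0 K unfolding d_def by (intro mult_right_mono) auto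
  finally have "\<bar>f x - f y - c n * D\<bar> \<le> D - \<eta> * (D / K)"
    using K by (simp add: field_simps)
  moreover have "\<bar>c n * D\<bar> = D" using c(2) D0 by (simp add: abs_mult)
  ultimately have "\<eta> * (D / K) \<le> \<bar>f x\<bar> + \<bar>f y\<bar>" by linarith
  moreover have "\<eta> * (y - x) \<le> \<eta> * (D / K)"
    using D K by (intro mult_left_mono) (auto simp: field_simps)
  moreover have "\<bar>f l\<bar> \<le> r / (u ^ a n * u powr K)" if "\<bar>\<Sum>i. c i * l ^ a i\<bar> \<le> r" "u \<le> l" for l
  proof -
    have "l powr (- (real (a n) + K)) \<le> u powr (- (real (a n) + K))"
      using uv that K by (intro powr_mono2') auto
    also have "\<dots> = 1 / (u ^ a n * u powr K)"
      using uv by (simp only: powr_minus_divide powr_add powr_realpow)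
    finally have "l powr (- (real (a n) + K)) \<le> 1 / (u ^ a n * u powr K)" .
    with that(1) have "\<bar>\<Sum>i. c i * l ^ a i\<bar> * l powr (- (real (a n) + K)) \<le> r * (1 / (u ^ a n * u powr K))"
      by (intro mult_mono') auto
    then show ?thesis by (simp add: f_def abs_mult)
  qed
  from this[of x] this[of y] have "\<bar>f x\<bar> + \<bar>f y\<bar> \<le> 2 * (r / (u ^ a n * u powr K))"
    using r uv by simp
  ultimately have "\<eta> * (y - x) \<le> 2 * (r / (u ^ a n * u powr K))" by linarith
  then have "y - x \<le> 2 * (r / (u ^ a n * u powr K)) / \<eta>"
    unfolding pos_le_divide_eq[OF K(2)] by (simp only: mult.commute)
  then show ?thesis by (simp add: mult_ac)
qed

lemma emeasure_lborel_le_diameter: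
  fixes S :: "real set"
  assumes "S \<in> sets borel" "0 \<le> e" "\<And>x y. x \<in> S \<Longrightarrow> y \<in> S \<Longrightarrow> x < y \<Longrightarrow> y - x \<le> e"
  shows "emeasure lborel S \<le> ennreal (2 * e)"
proof (cases "S = {}")
  case False
  then obtain z where z: "z \<in> S" by blast
  have "S \<subseteq> {z - e..z + e}"
  proof
    fix x assume "x \<in> S"
    then show "x \<in> {z - e..z + e}"
      using assms(2) assms(3)[of x z] assms(3)[of z x] z by (cases x z rule: linorder_cases) auto
  qed
  then have "emeasure lborel S \<le> emeasure lborel {z - e..z + e}"
    by (intro emeasure_mono) auto
  then show ?thesis using assms(2) by simp
qed simp

section \<open>Absolute continuity from correlation integrals\<close>

text \<open>With \<open>m x\<close> the mass of the \<open>r\<close>-ball at \<open>x\<close>, the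
  smoothed density \<open>m x / (2 * r)\<close> has its squared L2 norm controlled by the
  correlation integral, with a constant independent of \<open>r\<close>. Such a bound at arbitrarily
  small scales forces little mass on open sets of small Lebesgue measure, hence none on null
  sets.\<close>

lemma absolutely_continuous_lborel_criterion:
  fixes \<mu> :: "real measure" and C :: real
  assumes "finite_measure \<mu>" and sets[measurable_cong]: "sets \<mu> = sets borel" and "0 \<le> C"
    and freq: "\<And>\<delta>. 0 < \<delta> \<Longrightarrow> \<exists>r. 0 < r \<and> r < \<delta> \<and>
      (\<integral>\<^sup>+x. emeasure \<mu> {x - 2 * r..x + 2 * r} \<partial>\<mu>) \<le> ennreal (C * r)"
  shows "absolutely_continuous lborel \<mu>"
  unfolding absolutely_continuous_def
proof
  interpret finite_measure \<mu> by fact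
  interpret P: pair_sigma_finite lborel \<mu> by unfold_locales
  fix N :: "real set" assume N: "N \<in> null_sets lborel"
  then have [measurable]: "N \<in> sets borel" by auto
  define J :: "real \<Rightarrow> real \<Rightarrow> real \<Rightarrow> ennreal" where "J r x y = indicator {-r..r} (x - y)" for r x y
  have [measurable]: "(\<lambda>x. J r (f x) (g x)) \<in> borel_measurable L"
    if [measurable]: "f \<in> borel_measurable L" "g \<in> borel_measurable L" for f g r and L :: "'c measure"
    unfolding J_def by measurable
  have Jlb: "(\<integral>\<^sup>+x. J r x y \<partial>lborel) = ennreal (2 * r)" if "0 < r" for r y
  proof -
    have "(\<integral>\<^sup>+x. J r x y \<partial>lborel) = (\<integral>\<^sup>+x. indicator {y - r..y + r} x \<partial>lborel)"
      by (intro nn_integral_cong) (auto simp: J_def indicator_def)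
    then show ?thesis using that by simp
  qed
  have J\<mu>: "(\<integral>\<^sup>+x. J r y x \<partial>\<mu>) = emeasure \<mu> {y - r..y + r}" for r y
  proof -
    have "(\<integral>\<^sup>+x. J r y x \<partial>\<mu>) = (\<integral>\<^sup>+x. indicator {y - r..y + r} x \<partial>\<mu>)"
      by (intro nn_integral_cong) (auto simp: J_def indicator_def)
    then show ?thesis by (simp add: sets)
  qed
  have bound: "emeasure \<mu> N \<le> ennreal (\<theta> * (C + 1))" if \<theta>: "0 < \<theta>" for \<theta> :: real
  proof -
    obtain U where U: "open U" "N \<subseteq> U" "emeasure lborel (U - N) < ennreal (\<theta>\<^sup>2)"
      using outer_regular_lborel[of N "\<theta>\<^sup>2"] \<theta> by auto
    have [measurable]: "U \<in> sets borel" using U by simp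
    have "emeasure lborel U \<le> emeasure lborel ((U - N) \<union> N)"
      using U by (intro emeasure_mono) auto
    also have "\<dots> = emeasure lborel (U - N)"
      using N by (intro emeasure_Un_null_set) auto
    finally have U\<epsilon>: "emeasure lborel U \<le> ennreal (\<theta>\<^sup>2)"
      using U by simp
    \<comment> \<open>The points at distance at least \<open>1 / Suc k\<close> from the complement
      of \<open>U\<close>. Smoothing at a smaller scale keeps their mass inside \<open>U\<close>,
      and these sets exhaust \<open>U\<close>.\<close>
    define V where "V k = - (\<Union>y\<in>-U. ball y (1 / Suc k))" for k :: nat
    have [measurable]: "V k \<in> sets borel" for k
      unfolding V_def by (intro borel_closed) (auto simp: closed_Compl open_UN)
    have incV: "incseq V"
    proof (rule incseq_SucI)
      fix k
      have "ball y (1 / real (Suc (Suc k))) \<subseteq> ball y (1 / real (Suc k))" for y :: real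
        by (intro subset_ball) (auto simp: field_simps)
      then show "V k \<subseteq> V (Suc k)" unfolding V_def by blast
    qed
    have "U \<subseteq> (\<Union>k. V k)"
    proof
      fix x assume "x \<in> U"
      then obtain e where e: "0 < e" "ball x e \<subseteq> U" using U by (auto simp: open_contains_ball)
      obtain k where k: "1 / real (Suc k) < e" using nat_approx_posE[OF e(1)] by auto
      have "x \<in> V k"
      proof (rule ccontr)
        assume "x \<notin> V k"
        then obtain y where "y \<notin> U" "dist y x < 1 / Suc k" by (auto simp: V_def)
        then have "y \<in> ball x e" using k by (simp add: dist_commute)
        then show False using e \<open>y \<notin> U\<close> by auto
      qed
      then show "x \<in> (\<Union>k. V k)" by blast
    qed
    have Vk: "emeasure \<mu> (V k) \<le> ennreal (\<theta> * (C + 1))" for k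
    proof -
      obtain r where r: "0 < r" "r < 1 / Suc k"
        "(\<integral>\<^sup>+x. emeasure \<mu> {x - 2 * r..x + 2 * r} \<partial>\<mu>) \<le> ennreal (C * r)"
        using freq[of "1 / Suc k"] by auto
      define m where "m x = (\<integral>\<^sup>+y. J r x y \<partial>\<mu>)" for x
      have [measurable]: "m \<in> borel_measurable borel" unfolding m_def by measurable
      have fin: "m x = ennreal (measure \<mu> {x - r..x + r})" for x
        by (simp add: m_def J\<mu> emeasure_eq_measure)
      have VU: "indicator (V k) y * J r x y \<le> indicator U x * J r x y" for x y
      proof -
        have "x \<in> U" if "y \<in> V k" "x - y \<in> {-r..r}"
        proof (rule ccontr)
          assume "x \<notin> U"
          then have "y \<notin> ball x (1 / Suc k)" using that by (auto simp: V_def)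
          then show False using that r by (auto simp: dist_real_def abs_if split: if_splits)
        qed
        then show ?thesis by (auto simp: J_def indicator_def)
      qed
      have "(\<integral>\<^sup>+x. m x * m x \<partial>lborel) = (\<integral>\<^sup>+x. (\<integral>\<^sup>+y. (\<integral>\<^sup>+z. J r x y * J r x z \<partial>\<mu>) \<partial>\<mu>) \<partial>lborel)"
        unfolding m_def by (simp add: nn_integral_cmult nn_integral_multc)
      also have "\<dots> = (\<integral>\<^sup>+y. (\<integral>\<^sup>+x. (\<integral>\<^sup>+z. J r x y * J r x z \<partial>\<mu>) \<partial>lborel) \<partial>\<mu>)"
        by (rule P.Fubini'[symmetric]) measurable
      also have "\<dots> = (\<integral>\<^sup>+y. (\<integral>\<^sup>+z. (\<integral>\<^sup>+x. J r x y * J r x z \<partial>lborel) \<partial>\<mu>) \<partial>\<mu>)"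
        by (intro nn_integral_cong P.Fubini'[symmetric]) measurable
      \<comment> \<open>Two points within \<open>r\<close> of the same \<open>x\<close> are within
        \<open>2 * r\<close> of each other; hence the radius in the hypothesis.\<close>
      also have "\<dots> \<le> (\<integral>\<^sup>+y. (\<integral>\<^sup>+z. (\<integral>\<^sup>+x. J r x y * J (2 * r) y z \<partial>lborel) \<partial>\<mu>) \<partial>\<mu>)"
        by (intro nn_integral_mono) (auto simp: J_def indicator_def)
      also have "\<dots> = ennreal (2 * r) * (\<integral>\<^sup>+y. emeasure \<mu> {y - 2 * r..y + 2 * r} \<partial>\<mu>)"
        using r by (simp add: nn_integral_multc nn_integral_cmult Jlb flip: J\<mu>)
      also have "\<dots> \<le> ennreal (2 * r) * ennreal (C * r)"
        by (intro mult_left_mono r) simp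
      finally have mm: "(\<integral>\<^sup>+x. m x * m x \<partial>lborel) \<le> ennreal (2 * r) * ennreal (C * r)" .
      have "ennreal (2 * r) * emeasure \<mu> (V k) = (\<integral>\<^sup>+y. indicator (V k) y * (\<integral>\<^sup>+x. J r x y \<partial>lborel) \<partial>\<mu>)"
        using r by (simp add: Jlb nn_integral_multc mult.commute sets)
      also have "\<dots> = (\<integral>\<^sup>+y. (\<integral>\<^sup>+x. indicator (V k) y * J r x y \<partial>lborel) \<partial>\<mu>)"
        by (simp add: nn_integral_cmult)
      also have "\<dots> \<le> (\<integral>\<^sup>+y. (\<integral>\<^sup>+x. indicator U x * J r x y \<partial>lborel) \<partial>\<mu>)"
        by (intro nn_integral_mono VU)
      also have "\<dots> = (\<integral>\<^sup>+x. (\<integral>\<^sup>+y. indicator U x * J r x y \<partial>\<mu>) \<partial>lborel)"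
        by (rule P.Fubini') measurable
      also have "\<dots> = (\<integral>\<^sup>+x. indicator U x * m x \<partial>lborel)"
        unfolding m_def by (intro nn_integral_cong nn_integral_cmult) measurable
      \<comment> \<open>Young's inequality in place of Cauchy-Schwarz. The weights
        \<open>\<theta> / r\<close> and \<open>r / \<theta>\<close> make both resulting terms of
        order \<open>\<theta> * r\<close>.\<close>
      also have "\<dots> \<le> (\<integral>\<^sup>+x. ennreal (\<theta> / r) * (m x * m x) + ennreal (r / \<theta>) * indicator U x \<partial>lborel)"
      proof (rule nn_integral_mono)
        fix x
        define b where "b = measure \<mu> {x - r..x + r}"
        have "(\<theta> / r) * (b - r / \<theta>)\<^sup>2 = (\<theta> / r) * (b * b) - 2 * b + r / \<theta>"
          using \<theta> r by (simp add: power2_eq_square field_simps)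
        moreover have "0 \<le> (\<theta> / r) * (b - r / \<theta>)\<^sup>2" using \<theta> r by simp
        ultimately have "2 * b \<le> (\<theta> / r) * (b * b) + r / \<theta>"
          by simp
        moreover have "0 \<le> b" by (simp add: b_def)
        ultimately have "b \<le> (\<theta> / r) * (b * b) + r / \<theta>" by linarith
        then have "ennreal b \<le> ennreal (\<theta> / r) * (ennreal b * ennreal b) + ennreal (r / \<theta>)"
          using \<theta> r \<open>0 \<le> b\<close> by (simp add: ennreal_mult[symmetric] ennreal_plus[symmetric] del: ennreal_plus)
        then show "indicator U x * m x \<le> ennreal (\<theta> / r) * (m x * m x) + ennreal (r / \<theta>) * indicator U x"
          by (auto simp: fin b_def indicator_def)
      qed
      also have "\<dots> = ennreal (\<theta> / r) * (\<integral>\<^sup>+x. m x * m x \<partial>lborel) + ennreal (r / \<theta>) * emeasure lborel U"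
        by (simp add: nn_integral_add nn_integral_cmult)
      finally have "ennreal (2 * r) * emeasure \<mu> (V k) \<le>
          ennreal (\<theta> / r) * (ennreal (2 * r) * ennreal (C * r)) + ennreal (r / \<theta>) * ennreal (\<theta>\<^sup>2)"
        using add_mono[OF mult_left_mono[OF mm] mult_left_mono[OF U\<epsilon>], of "ennreal (\<theta> / r)" "ennreal (r / \<theta>)"]
        by (simp add: order_trans)
      also have "\<dots> = ennreal (\<theta> / r * (2 * r * (C * r)) + r / \<theta> * \<theta>\<^sup>2)"
        using \<theta> r \<open>0 \<le> C\<close> by (simp add: ennreal_mult[symmetric] ennreal_plus[symmetric] del: ennreal_plus)
      also have "\<dots> \<le> ennreal (2 * r * (\<theta> * (C + 1)))"
        using \<theta> r by (intro ennreal_leI) (simp add: power2_eq_square field_simps)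
      finally have "ennreal (2 * r * measure \<mu> (V k)) \<le> ennreal (2 * r * (\<theta> * (C + 1)))"
        using r by (simp add: emeasure_eq_measure ennreal_mult)
      then have "2 * r * measure \<mu> (V k) \<le> 2 * r * (\<theta> * (C + 1))"
        using \<theta> r \<open>0 \<le> C\<close> by (subst (asm) ennreal_le_iff) auto
      then show ?thesis using r by (simp add: emeasure_eq_measure ennreal_leI)
    qed
    have "emeasure \<mu> N \<le> emeasure \<mu> (\<Union>k. V k)"
      using U \<open>U \<subseteq> _\<close> by (intro emeasure_mono) (auto simp: sets)
    also have "\<dots> = (SUP k. emeasure \<mu> (V k))"
      using incV by (intro SUP_emeasure_incseq[symmetric]) (auto simp: sets)
    also have "\<dots> \<le> ennreal (\<theta> * (C + 1))"
      by (intro SUP_least Vk)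
    finally show ?thesis .
  qed
  have "measure \<mu> N \<le> 0"
  proof (rule field_le_epsilon)
    fix e :: real assume "0 < e"
    then show "measure \<mu> N \<le> 0 + e"
      using bound[of "e / (C + 1)"] \<open>0 \<le> C\<close> by (simp add: emeasure_eq_measure)
  qed
  then have "emeasure \<mu> N = 0"
    by (simp add: emeasure_eq_measure ennreal_eq_0_iff)
  then show "N \<in> null_sets \<mu>" by (simp add: null_sets_def sets)
qed

text \<open>For outcomes first differing at digit \<open>n\<close>, the parameters giving nearby
  sums have measure \<open>O(r / u ^ a n)\<close>, while a good outcome has its
  \<open>n\<close>-cylinder of probability \<open>O(\<rho> ^ n)\<close>. Summability of
  \<open>\<rho> ^ n / u ^ a n\<close> makes the mean correlation integral \<open>O(r)\<close>, and
  Fatou's lemma passes to individual \<open>l\<close>.\<close>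

lemma (in prob_space) AE_absolutely_continuous_lacunary_series:
  fixes X :: "nat \<Rightarrow> 'a \<Rightarrow> real" and a :: "nat \<Rightarrow> nat" and u v K \<eta> \<rho> :: real
  assumes X[measurable]: "\<And>i. X i \<in> borel_measurable M" and X01: "\<And>i \<omega>. X i \<omega> \<in> {0, 1}"
    and a: "strict_mono a" and uv: "0 < u" "u \<le> v" "v < 1" and K: "0 < K" "0 < \<eta>"
    and sm: "\<And>n. summable (\<lambda>t. \<bar>real (a (n + 1 + t) - a n) - K\<bar> * v ^ (a (n + 1 + t) - a n))"
    and le: "\<And>n. (\<Sum>t. \<bar>real (a (n + 1 + t) - a n) - K\<bar> * v ^ (a (n + 1 + t) - a n)) \<le> K - \<eta>"
    and \<rho>: "0 < \<rho>" "\<rho> < 1" "summable (\<lambda>n. \<rho> ^ n / u ^ a n)"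
    and cyl: "AE \<omega> in M. eventually (\<lambda>n. prob {\<tau> \<in> space M. \<forall>i<n. X i \<tau> = X i \<omega>} \<le> \<rho> ^ n) sequentially"
  shows "AE l in lborel. l \<in> {u..v} \<longrightarrow>
    absolutely_continuous lborel (distr M borel (\<lambda>\<omega>. \<Sum>i. X i \<omega> * l ^ a i))"
proof -
  interpret LM: pair_sigma_finite lborel M by unfold_locales
  define S where "S l \<omega> = (\<Sum>i. X i \<omega> * l ^ a i)" for l \<omega>
  have S_meas[measurable]: "(\<lambda>x. S (f x) (g x)) \<in> borel_measurable L"
    if [measurable]: "f \<in> borel_measurable L" "g \<in> measurable L M" for f g and L :: "'c measure"
    unfolding S_def by measurable
  define P where "P n \<omega> = prob {\<tau> \<in> space M. \<forall>i<n. X i \<tau> = X i \<omega>}" for n \<omega>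
  have [measurable]: "P n \<in> borel_measurable M" for n
  proof -
    define B where "B = {z \<in> space (M \<Otimes>\<^sub>M M). \<forall>i<n. X i (snd z) = X i (fst z)}"
    have [measurable]: "B \<in> sets (M \<Otimes>\<^sub>M M)" unfolding B_def by measurable
    have "(\<lambda>\<omega>. enn2real (emeasure M (Pair \<omega> -` B))) \<in> borel_measurable M"
      by (intro borel_measurable_enn2real measurable_emeasure_Pair) simp
    also have "?this \<longleftrightarrow> ?thesis"
      by (intro measurable_cong) (auto simp: P_def B_def measure_def space_pair_measure
        intro!: arg_cong[where f = "\<lambda>A. enn2real (emeasure M A)"])
    finally show ?thesis .
  qed
  \<comment> \<open>On \<open>G N\<close> the cylinder bound starts at a common index. By
    \<open>cyl\<close> these events exhaust the space up to a null set, so each may be treated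
    separately.\<close>
  define G where "G N = {\<omega> \<in> space M. \<forall>n\<ge>N. P n \<omega> \<le> \<rho> ^ n}" for N
  have [measurable]: "G N \<in> sets M" for N unfolding G_def by measurable
  define E where "E N r l = (\<integral>\<^sup>+\<omega>. (\<integral>\<^sup>+\<tau>. indicator (G N) \<omega> * (indicator (G N) \<tau> *
      indicator {-2 * r..2 * r} (S l \<omega> - S l \<tau>)) \<partial>M) \<partial>M)" for N r l
  have [measurable]: "E N r \<in> borel_measurable lborel" for N r
    unfolding E_def by measurable
  have X_abs: "\<bar>X i \<omega>\<bar> \<le> 1" for i \<omega>
    using X01[of i \<omega>] by auto
  \<comment> \<open>The \<open>8\<close> collects the factor \<open>2\<close> of the diameter bound,
    the \<open>2\<close> of transversality and the radius \<open>2 * r\<close>.\<close>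
  define D where "D = 8 / (\<eta> * u powr K)"
  have D: "0 < D" unfolding D_def using uv K by simp
  \<comment> \<open>The right side depends on \<open>\<tau>\<close> only through cylinders around
    \<open>\<omega>\<close>, so integrating over \<open>\<tau>\<close> produces cylinder
    probabilities. Its term at the first disagreement alone dominates the left side.\<close>
  have level_set: "(\<integral>\<^sup>+l. indicator {u..v} l * indicator {-2 * r..2 * r} (S l \<omega> - S l \<tau>) \<partial>lborel)
    \<le> (\<Sum>n. ennreal (D * r / u ^ a n) * indicator {\<tau> \<in> space M. \<forall>i<n. X i \<tau> = X i \<omega>} \<tau>)" (is "?L \<le> ?R")
    if r: "0 < r" and \<omega>: "\<omega> \<in> space M" "\<tau> \<in> space M" for r \<omega> \<tau>
  proof (cases "\<forall>i. X i \<omega> = X i \<tau>")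
    case True
    have "?R = (\<Sum>n. ennreal (D * r / u ^ a n))"
      using True \<omega> by (intro suminf_cong) auto
    \<comment> \<open>For identical digit sequences the bound is trivial: the terms stay at or above
      \<open>D * r\<close>, so the series diverges.\<close>
    also have "\<dots> = top"
    proof (rule ccontr)
      assume "(\<Sum>n. ennreal (D * r / u ^ a n)) \<noteq> top"
      then have "summable (\<lambda>n. D * r / u ^ a n)"
        using D r uv by (intro summable_suminf_not_top) auto
      then have "(\<lambda>n. D * r / u ^ a n) \<longlonglongrightarrow> 0" by (rule summable_LIMSEQ_zero)
      moreover have "D * r \<le> D * r / u ^ a n" for n
        using D r uv power_le_one[of u "a n"] mult_left_mono[of "u ^ a n" 1 "D * r"]
        by (simp add: le_divide_eq)
      ultimately have "D * r \<le> 0"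
        by (intro LIMSEQ_le_const) auto
      then show False using D r by (simp add: mult_le_0_iff)
    qed
    finally show ?thesis by simp
  next
    case False
    define n where "n = (LEAST i. X i \<omega> \<noteq> X i \<tau>)"
    have n: "X n \<omega> \<noteq> X n \<tau>" unfolding n_def using False LeastI_ex[of "\<lambda>i. X i \<omega> \<noteq> X i \<tau>"] by blast
    have n': "X i \<omega> = X i \<tau>" if "i < n" for i using not_less_Least that by (auto simp: n_def)
    define c where "c i = X i \<omega> - X i \<tau>" for i
    have c: "\<bar>c i\<bar> \<le> 1" for i
      using X01[of i \<omega>] X01[of i \<tau>] by (auto simp: c_def)
    have c1: "\<bar>c n\<bar> = 1"
      using X01[of n \<omega>] X01[of n \<tau>] n by (auto simp: c_def)
    have Xs: "summable (\<lambda>i. X i \<omega> * l ^ a i)" if "u \<le> l" "l \<le> v" for l \<omega>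
      using that uv by (intro summable_lacunary a X_abs) auto
    have S: "S l \<omega> - S l \<tau> = (\<Sum>i. c i * l ^ a i)" if "u \<le> l" "l \<le> v" for l
      unfolding S_def c_def left_diff_distrib by (intro suminf_diff Xs that)
    define T where "T = {l. u \<le> l \<and> l \<le> v \<and> \<bar>S l \<omega> - S l \<tau>\<bar> \<le> 2 * r}"
    have [measurable]: "T \<in> sets borel" unfolding T_def using \<omega> by measurable
    have "?L = (\<integral>\<^sup>+l. indicator T l \<partial>lborel)"
      by (intro nn_integral_cong) (auto simp: T_def indicator_def)
    also have "\<dots> = emeasure lborel T" by simp
    also have "\<dots> \<le> ennreal (2 * (2 * (2 * r) / (\<eta> * u ^ a n * u powr K)))"
    proof (rule emeasure_lborel_le_diameter)
      fix x y assume xy: "x \<in> T" "y \<in> T" "x < y"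
      show "y - x \<le> 2 * (2 * r) / (\<eta> * u ^ a n * u powr K)"
      proof (rule lacunary_series_transversality[OF a])
        show "\<bar>\<Sum>i. c i * x ^ a i\<bar> \<le> 2 * r" "\<bar>\<Sum>i. c i * y ^ a i\<bar> \<le> 2 * r"
          using xy S by (auto simp: T_def)
        show "c i = 0" if "i < n" for i using n'[OF that] by (simp add: c_def)
      qed (use xy uv K c c1 sm[of n] le[of n] in \<open>auto simp: T_def\<close>)
    qed (use uv r K in auto)
    also have "2 * (2 * (2 * r) / (\<eta> * u ^ a n * u powr K)) = D * r / u ^ a n"
      by (simp add: D_def)
    also have "ennreal (D * r / u ^ a n) = (\<Sum>k\<in>{n}. ennreal (D * r / u ^ a k) * indicator {\<tau> \<in> space M. \<forall>i<k. X i \<tau> = X i \<omega>} \<tau>)"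
      using n' \<omega> by simp
    also have "\<dots> \<le> ?R" by (intro sum_le_suminf) auto
    finally show ?thesis .
  qed
  have int_E: "\<exists>C. \<forall>r>0. (\<integral>\<^sup>+l. indicator {u..v} l * E N r l \<partial>lborel) \<le> ennreal (C * r)" for N
  proof (intro exI allI impI)
    define Z where "Z = (\<Sum>n. \<rho> ^ n / u ^ a n)"
    fix r :: real assume r: "0 < r"
    have "(\<integral>\<^sup>+l. indicator {u..v} l * E N r l \<partial>lborel) =
      (\<integral>\<^sup>+l. (\<integral>\<^sup>+\<omega>. (\<integral>\<^sup>+\<tau>. indicator {u..v} l * (indicator (G N) \<omega> * (indicator (G N) \<tau> *
      indicator {-2 * r..2 * r} (S l \<omega> - S l \<tau>))) \<partial>M) \<partial>M) \<partial>lborel)"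
      unfolding E_def by (simp add: nn_integral_cmult)
    also have "\<dots> = (\<integral>\<^sup>+\<omega>. (\<integral>\<^sup>+l. (\<integral>\<^sup>+\<tau>. indicator {u..v} l * (indicator (G N) \<omega> * (indicator (G N) \<tau> *
      indicator {-2 * r..2 * r} (S l \<omega> - S l \<tau>))) \<partial>M) \<partial>lborel) \<partial>M)"
      by (rule LM.Fubini'[symmetric]) measurable
    also have "\<dots> = (\<integral>\<^sup>+\<omega>. (\<integral>\<^sup>+\<tau>. (\<integral>\<^sup>+l. indicator {u..v} l * (indicator (G N) \<omega> * (indicator (G N) \<tau> *
      indicator {-2 * r..2 * r} (S l \<omega> - S l \<tau>))) \<partial>lborel) \<partial>M) \<partial>M)"
      by (intro nn_integral_cong LM.Fubini'[symmetric]) measurable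
    also have "\<dots> \<le> (\<integral>\<^sup>+\<omega>. ennreal (D * r / \<rho> ^ N * Z) \<partial>M)"
    proof (rule nn_integral_mono)
      fix \<omega> assume \<omega>: "\<omega> \<in> space M"
      show "(\<integral>\<^sup>+\<tau>. (\<integral>\<^sup>+l. indicator {u..v} l * (indicator (G N) \<omega> * (indicator (G N) \<tau> *
          indicator {-2 * r..2 * r} (S l \<omega> - S l \<tau>))) \<partial>lborel) \<partial>M) \<le> ennreal (D * r / \<rho> ^ N * Z)"
      proof (cases "\<omega> \<in> G N")
        case True
        \<comment> \<open>For \<open>n < N\<close> the trivial bound \<open>1\<close> is at most
          \<open>\<rho> ^ n / \<rho> ^ N\<close>, so the constant \<open>1 / \<rho> ^ N\<close>
          absorbs the finitely many uncontrolled cylinders.\<close>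
        have P: "P n \<omega> \<le> \<rho> ^ n / \<rho> ^ N" for n
        proof (cases "N \<le> n")
          case True
          then have "P n \<omega> \<le> \<rho> ^ n" using \<open>\<omega> \<in> G N\<close> by (auto simp: G_def)
          also have "\<dots> \<le> \<rho> ^ n / \<rho> ^ N"
            using \<rho> power_le_one[of \<rho> N] mult_left_mono[of "\<rho> ^ N" 1 "\<rho> ^ n"] by (simp add: le_divide_eq)
          finally show ?thesis .
        next
          case False
          then have "\<rho> ^ N \<le> \<rho> ^ n" using \<rho> by (intro power_decreasing) auto
          then have "1 \<le> \<rho> ^ n / \<rho> ^ N" using \<rho> by simp
          moreover have "P n \<omega> \<le> 1" unfolding P_def by simp
          ultimately show ?thesis by linarith
        qed
        have "(\<integral>\<^sup>+\<tau>. (\<integral>\<^sup>+l. indicator {u..v} l * (indicator (G N) \<omega> * (indicator (G N) \<tau> *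
            indicator {-2 * r..2 * r} (S l \<omega> - S l \<tau>))) \<partial>lborel) \<partial>M)
          \<le> (\<integral>\<^sup>+\<tau>. (\<integral>\<^sup>+l. indicator {u..v} l * indicator {-2 * r..2 * r} (S l \<omega> - S l \<tau>) \<partial>lborel) \<partial>M)"
          by (intro nn_integral_mono) (auto simp: indicator_def)
        also have "\<dots> \<le> (\<integral>\<^sup>+\<tau>. (\<Sum>n. ennreal (D * r / u ^ a n) * indicator {\<tau> \<in> space M. \<forall>i<n. X i \<tau> = X i \<omega>} \<tau>) \<partial>M)"
          using r \<omega> by (intro nn_integral_mono level_set)
        also have "\<dots> = (\<Sum>n. ennreal (D * r / u ^ a n) * ennreal (P n \<omega>))"
          by (subst nn_integral_suminf) (auto simp: nn_integral_cmult P_def emeasure_eq_measure)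
        also have "\<dots> \<le> (\<Sum>n. ennreal (D * r / \<rho> ^ N * (\<rho> ^ n / u ^ a n)))"
        proof (intro suminf_le)
          fix n
          have "D * r / u ^ a n * P n \<omega> \<le> D * r / u ^ a n * (\<rho> ^ n / \<rho> ^ N)"
            using D r uv by (intro mult_left_mono P) auto
          then show "ennreal (D * r / u ^ a n) * ennreal (P n \<omega>) \<le> ennreal (D * r / \<rho> ^ N * (\<rho> ^ n / u ^ a n))"
            using D r uv by (simp add: P_def ennreal_mult[symmetric] mult_ac ennreal_leI)
        qed auto
        also have "\<dots> = ennreal (D * r / \<rho> ^ N * Z)"
          unfolding Z_def suminf_mult[OF \<rho>(3), symmetric]
          using \<rho> D r uv by (intro suminf_ennreal2 summable_mult) auto
        finally show ?thesis .
      qed simp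
    qed
    also have "\<dots> = ennreal (D / \<rho> ^ N * Z * r)"
      by (simp add: emeasure_space_1 mult_ac)
    finally show "(\<integral>\<^sup>+l. indicator {u..v} l * E N r l \<partial>lborel) \<le> ennreal (D / \<rho> ^ N * Z * r)" .
  qed
  define \<mu> where "\<mu> N l = distr (density M (indicator (G N))) borel (S l)" for N l
  have ac: "AE l in lborel. l \<in> {u..v} \<longrightarrow> absolutely_continuous lborel (\<mu> N l)" for N
  proof -
    obtain C where C: "\<And>r. 0 < r \<Longrightarrow> (\<integral>\<^sup>+l. indicator {u..v} l * E N r l \<partial>lborel) \<le> ennreal (C * r)"
      using int_E[of N] by blast
    \<comment> \<open>Correlation integrals divided by the scale \<open>1 / Suc m\<close>. Fatou's
      lemma makes their lower limit finite for almost every \<open>l\<close>, which yields the bound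
      of the criterion along arbitrarily small scales.\<close>
    define g where "g m l = ennreal (real (Suc m)) * (indicator {u..v} l * E N (1 / Suc m) l)" for m l
    have [measurable]: "g m \<in> borel_measurable lborel" for m unfolding g_def by measurable
    have "(\<integral>\<^sup>+l. liminf (\<lambda>m. g m l) \<partial>lborel) \<le> liminf (\<lambda>m. (\<integral>\<^sup>+l. g m l \<partial>lborel))"
      by (rule nn_integral_liminf) measurable
    also have "\<dots> \<le> liminf (\<lambda>m. ennreal C)"
    proof (intro Liminf_mono always_eventually allI)
      fix m
      have "(\<integral>\<^sup>+l. g m l \<partial>lborel) \<le> ennreal (real (Suc m)) * ennreal (C * (1 / Suc m))"
        unfolding g_def by (subst nn_integral_cmult) (measurable, intro mult_left_mono C, simp_all)
      also have "\<dots> = ennreal C"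
        by (subst ennreal_mult'[symmetric]) simp_all
      finally show "(\<integral>\<^sup>+l. g m l \<partial>lborel) \<le> ennreal C" .
    qed
    also have "\<dots> = ennreal C" by (simp add: Liminf_const)
    finally have "(\<integral>\<^sup>+l. liminf (\<lambda>m. g m l) \<partial>lborel) \<noteq> \<infinity>"
      using ennreal_less_top le_less_trans by (auto simp: top_unique)
    then have "AE l in lborel. liminf (\<lambda>m. g m l) \<noteq> \<infinity>"
      by (intro nn_integral_PInf_AE) measurable
    then show ?thesis
    proof (rule AE_mp, intro AE_I2 impI)
      fix l assume l: "liminf (\<lambda>m. g m l) \<noteq> \<infinity>" "l \<in> {u..v}"
      then obtain c where c: "0 \<le> c" "liminf (\<lambda>m. g m l) = ennreal c" by (cases "liminf (\<lambda>m. g m l)") auto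
      have "\<not> eventually (\<lambda>m. ennreal (c + 1) \<le> g m l) sequentially"
      proof
        assume "eventually (\<lambda>m. ennreal (c + 1) \<le> g m l) sequentially"
        then have "ennreal (c + 1) \<le> liminf (\<lambda>m. g m l)" by (rule Liminf_bounded)
        then show False using c by (simp add: ennreal_le_iff)
      qed
      then have fr: "\<exists>m\<ge>m0. g m l < ennreal (c + 1)" for m0
        by (auto simp: eventually_sequentially not_le)
      show "absolutely_continuous lborel (\<mu> N l)"
      proof (rule absolutely_continuous_lborel_criterion)
        show "finite_measure (\<mu> N l)"
        proof
          show "emeasure (\<mu> N l) (space (\<mu> N l)) \<noteq> \<infinity>"
            by (simp add: \<mu>_def emeasure_distr emeasure_density emeasure_eq_measure)
        qed
        show "sets (\<mu> N l) = sets borel" by (simp add: \<mu>_def)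
        show "0 \<le> c + 1" using c by simp
        fix \<delta> :: real assume "0 < \<delta>"
        then obtain m0 where m0: "1 / real (Suc m0) < \<delta>" using nat_approx_posE by blast
        obtain m where m: "m0 \<le> m" "g m l < ennreal (c + 1)" using fr by blast
        define r where "r = 1 / real (Suc m)"
        have "r \<le> 1 / real (Suc m0)" unfolding r_def using m(1) by (intro frac_le) auto
        then have r: "0 < r" "r < \<delta>" using m0 by (auto simp: r_def)
        have "(\<integral>\<^sup>+x. emeasure (\<mu> N l) {x - 2 * r..x + 2 * r} \<partial>\<mu> N l) =
          (\<integral>\<^sup>+x. (\<integral>\<^sup>+\<tau>. indicator (G N) \<tau> * indicator {-2 * r..2 * r} (x - S l \<tau>) \<partial>M) \<partial>\<mu> N l)"
        proof (rule nn_integral_cong)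
          fix x
          have "emeasure (\<mu> N l) {x - 2 * r..x + 2 * r} = (\<integral>\<^sup>+y. indicator {x - 2 * r..x + 2 * r} y \<partial>\<mu> N l)"
            by (simp add: \<mu>_def)
          also have "\<dots> = (\<integral>\<^sup>+\<tau>. indicator (G N) \<tau> * indicator {x - 2 * r..x + 2 * r} (S l \<tau>) \<partial>M)"
            unfolding \<mu>_def by (subst nn_integral_distr) (auto simp: nn_integral_density)
          also have "\<dots> = (\<integral>\<^sup>+\<tau>. indicator (G N) \<tau> * indicator {-2 * r..2 * r} (x - S l \<tau>) \<partial>M)"
            by (intro nn_integral_cong) (auto simp: indicator_def)
          finally show "emeasure (\<mu> N l) {x - 2 * r..x + 2 * r} =
            (\<integral>\<^sup>+\<tau>. indicator (G N) \<tau> * indicator {-2 * r..2 * r} (x - S l \<tau>) \<partial>M)" .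
        qed
        also have "\<dots> = E N r l"
          unfolding \<mu>_def E_def
          by (subst nn_integral_distr) (auto simp: nn_integral_density nn_integral_cmult)
        also have "\<dots> \<le> ennreal ((c + 1) * r)"
        proof -
          have "E N r l = ennreal r * g m l"
            using l(2) by (simp add: g_def r_def[symmetric] mult.assoc[symmetric] ennreal_mult[symmetric] r(1) less_imp_le del: of_nat_Suc)
              (simp add: r_def del: of_nat_Suc)
          also have "\<dots> \<le> ennreal r * ennreal (c + 1)"
            using m by (intro mult_left_mono) auto
          also have "\<dots> = ennreal ((c + 1) * r)"
            using r by (simp only: ennreal_mult'[symmetric] mult.commute less_imp_le)
          finally show ?thesis .
        qed
        finally show "\<exists>r>0. r < \<delta> \<and> (\<integral>\<^sup>+x. emeasure (\<mu> N l) {x - 2 * r..x + 2 * r} \<partial>\<mu> N l) \<le> ennreal ((c + 1) * r)"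
          using r by blast
      qed
    qed
  qed
  have "AE l in lborel. \<forall>N. l \<in> {u..v} \<longrightarrow> absolutely_continuous lborel (\<mu> N l)"
    unfolding AE_all_countable using ac by blast
  then show ?thesis
  proof (rule AE_mp, intro AE_I2 impI)
    fix l assume ac: "\<forall>N. l \<in> {u..v} \<longrightarrow> absolutely_continuous lborel (\<mu> N l)" and l: "l \<in> {u..v}"
    show "absolutely_continuous lborel (distr M borel (\<lambda>\<omega>. \<Sum>i. X i \<omega> * l ^ a i))"
      unfolding absolutely_continuous_def S_def[symmetric]
    proof
      fix B assume B: "B \<in> null_sets (lborel :: real measure)"
      then have [measurable]: "B \<in> sets borel" by auto
      have "AE \<omega> in M. \<omega> \<in> G N \<longrightarrow> S l \<omega> \<notin> B" for N
      proof -
        have "B \<in> null_sets (\<mu> N l)"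
          using ac l B by (auto simp: absolutely_continuous_def)
        then have "AE x in \<mu> N l. x \<notin> B" by (rule AE_not_in)
        then show ?thesis
          unfolding \<mu>_def by (subst (asm) AE_distr_iff) (auto simp: AE_density indicator_def)
      qed
      then have "AE \<omega> in M. \<forall>N. \<omega> \<in> G N \<longrightarrow> S l \<omega> \<notin> B"
        unfolding AE_all_countable by blast
      moreover have "AE \<omega> in M. \<exists>N. \<omega> \<in> G N"
        using cyl AE_space by eventually_elim (auto simp: G_def P_def eventually_sequentially)
      ultimately have "AE \<omega> in M. S l \<omega> \<notin> B"
        by eventually_elim blast
      then have "AE x in distr M borel (S l). x \<notin> B"
        by (subst AE_distr_iff) auto
      then show "B \<in> null_sets (distr M borel (S l))"
        by (subst (asm) AE_iff_null_sets[symmetric]) auto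
    qed
  qed
qed

section \<open>Cylinder probabilities\<close>

text \<open>At \<open>s = 0\<close> both sides equal \<open>1\<close>, and their difference has
  derivative \<open>p * ln p + (1 - p) * ln (1 - p) - ln \<rho>\<close> there, which is negative by
  the choice of \<open>\<rho>\<close>.\<close>

lemma ex_power_moment_less:
  fixes p \<rho> :: real
  assumes p: "0 < p" "p < 1" and \<rho>: "p powr p * (1 - p) powr (1 - p) < \<rho>"
  shows "\<exists>s>0. p powr (1 + s) + (1 - p) powr (1 + s) < \<rho> powr s"
proof -
  have T: "0 < p powr p * (1 - p) powr (1 - p)" using p by simp
  then have \<rho>0: "0 < \<rho>" using \<rho> by linarith
  have "ln (p powr p * (1 - p) powr (1 - p)) < ln \<rho>"
    using T \<rho> \<rho>0 by (subst ln_less_cancel_iff) auto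
  then have neg: "p * ln p + (1 - p) * ln (1 - p) - ln \<rho> < 0"
    using p by (simp add: ln_mult ln_powr)
  have "((\<lambda>s. p powr (1 + s) + (1 - p) powr (1 + s) - \<rho> powr s) has_real_derivative
      p * ln p + (1 - p) * ln (1 - p) - ln \<rho>) (at 0)"
    using p \<rho>0 by (auto intro!: derivative_eq_intros)
  from DERIV_neg_dec_right[OF this neg] obtain d where "0 < d" and
    d: "\<And>h. 0 < h \<Longrightarrow> h < d \<Longrightarrow> p powr (1 + (0 + h)) + (1 - p) powr (1 + (0 + h)) - \<rho> powr (0 + h)
      < p powr (1 + 0) + (1 - p) powr (1 + 0) - \<rho> powr 0"
    by blast
  from d[of "d / 2"] \<open>0 < d\<close> p \<rho>0 show ?thesis
    by (intro exI[of _ "d / 2"]) simp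
qed

text \<open>Markov's inequality for the \<open>s\<close>-th power of the cylinder probability over
  \<open>\<rho> ^ n\<close>: by independence its mean is a product of factors tending to a limit
  below \<open>1\<close>. The exceptional events thus have summable probabilities, and
  Borel-Cantelli applies.\<close>

lemma (in prob_space) AE_eventually_cylinder_le:
  fixes X :: "nat \<Rightarrow> 'a \<Rightarrow> real" and p \<rho> :: real
  assumes ind: "indep_vars (\<lambda>_. borel) X UNIV" and X01: "\<And>i \<omega>. X i \<omega> \<in> {0, 1}"
    and lim: "(\<lambda>i. prob {\<omega> \<in> space M. X i \<omega> = 0}) \<longlonglongrightarrow> p"
    and p: "0 < p" "p < 1" and \<rho>: "p powr p * (1 - p) powr (1 - p) < \<rho>"
  shows "AE \<omega> in M. eventually (\<lambda>n. prob {\<tau> \<in> space M. \<forall>i<n. X i \<tau> = X i \<omega>} \<le> \<rho> ^ n) sequentially"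
proof -
  have [measurable]: "X i \<in> borel_measurable M" for i
    using ind by (auto simp: indep_vars_def)
  have \<rho>0: "0 < \<rho>"
    using \<rho> by (rule le_less_trans[rotated]) simp
  obtain s where s: "0 < s" "p powr (1 + s) + (1 - p) powr (1 + s) < \<rho> powr s"
    using ex_power_moment_less[OF p \<rho>] by blast
  define q where "q i = prob {\<omega> \<in> space M. X i \<omega> = 0}" for i
  have q: "0 \<le> q i" "q i \<le> 1" for i by (auto simp: q_def)
  have q1: "prob {\<omega> \<in> space M. X i \<omega> = 1} = 1 - q i" for i
  proof -
    have "{\<omega> \<in> space M. X i \<omega> = 1} = space M - {\<omega> \<in> space M. X i \<omega> = 0}"
      using X01[of i] by auto
    then show ?thesis by (simp add: q_def prob_compl)
  qed
  define Q where "Q i x = (if x = 0 then q i else 1 - q i)" for i and x :: real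
  have Q: "0 \<le> Q i x" for i x using q by (simp add: Q_def)
  have [measurable]: "Q i \<in> borel_measurable borel" for i unfolding Q_def by measurable
  have Q_prob: "prob {\<tau> \<in> space M. X i \<tau> = X i \<omega>} = Q i (X i \<omega>)" for i \<omega>
    using X01[of i \<omega>] q1[of i] by (auto simp: Q_def q_def)
  have cyl: "prob {\<tau> \<in> space M. \<forall>i<n. X i \<tau> = X i \<omega>} = (\<Prod>i<n. Q i (X i \<omega>))" for n \<omega>
  \<comment> \<open>An empty intersection would be the whole type instead of
    \<open>space M\<close>.\<close>
  proof (cases "n = 0")
    case False
    have "{\<tau> \<in> space M. \<forall>i<n. X i \<tau> = X i \<omega>} = (\<Inter>i\<in>{..<n}. X i -` {X i \<omega>} \<inter> space M)"
      using False by auto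
    also have "prob \<dots> = (\<Prod>i<n. prob (X i -` {X i \<omega>} \<inter> space M))"
      using False by (intro indep_varsD[OF ind]) auto
    also have "\<dots> = (\<Prod>i<n. Q i (X i \<omega>))"
      unfolding Q_prob[symmetric] by (intro prod.cong refl arg_cong[where f = prob]) auto
    finally show ?thesis .
  qed (simp add: prob_space)
  \<comment> \<open>The mean of \<open>(Q i (X i \<omega>) / \<rho>) powr s\<close>; each value is
    weighted by its own probability, hence the exponent \<open>1 + s\<close>.\<close>
  define R where "R i = (q i powr (1 + s) + (1 - q i) powr (1 + s)) / \<rho> powr s" for i
  have R0: "0 \<le> R i" for i unfolding R_def by simp
  define Z where "Z i \<omega> = ennreal (Q i (X i \<omega>) powr s / \<rho> powr s)" for i \<omega>
  have indZ: "indep_vars (\<lambda>_. borel) Z {..<n}" for n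
    unfolding Z_def
    by (rule indep_vars_compose2[OF indep_vars_subset[OF ind]]) auto
  have intZ: "(\<integral>\<^sup>+\<omega>. Z i \<omega> \<partial>M) = ennreal (R i)" for i
  proof -
    have mul: "x powr s * x = x powr (1 + s)" if "0 \<le> x" for x :: real
      using that by (cases "x = 0") (auto simp: powr_add)
    have "(\<integral>\<^sup>+\<omega>. Z i \<omega> \<partial>M) = (\<integral>\<^sup>+\<omega>. ennreal (q i powr s / \<rho> powr s) * indicator {\<omega> \<in> space M. X i \<omega> = 0} \<omega> +
        ennreal ((1 - q i) powr s / \<rho> powr s) * indicator {\<omega> \<in> space M. X i \<omega> = 1} \<omega> \<partial>M)"
    proof (rule nn_integral_cong)
      fix \<omega> assume "\<omega> \<in> space M"
      then show "Z i \<omega> = ennreal (q i powr s / \<rho> powr s) * indicator {\<omega> \<in> space M. X i \<omega> = 0} \<omega> +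
        ennreal ((1 - q i) powr s / \<rho> powr s) * indicator {\<omega> \<in> space M. X i \<omega> = 1} \<omega>"
        using X01[of i \<omega>] by (auto simp: Z_def Q_def)
    qed
    also have "\<dots> = ennreal (q i powr s / \<rho> powr s) * ennreal (q i) + ennreal ((1 - q i) powr s / \<rho> powr s) * ennreal (1 - q i)"
      by (subst nn_integral_add) (auto simp: nn_integral_cmult emeasure_eq_measure q1 simp flip: q_def)
    also have "\<dots> = ennreal (q i powr s / \<rho> powr s * q i + (1 - q i) powr s / \<rho> powr s * (1 - q i))"
      using q[of i] by (simp add: ennreal_mult[symmetric] ennreal_plus[symmetric] del: ennreal_plus)
    also have "q i powr s / \<rho> powr s * q i + (1 - q i) powr s / \<rho> powr s * (1 - q i) = R i"
      using q[of i] by (simp add: R_def add_divide_distrib flip: mul)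
    finally show ?thesis .
  qed
  define B where "B n = {\<omega> \<in> space M. \<rho> ^ n < (\<Prod>i<n. Q i (X i \<omega>))}" for n
  have [measurable]: "B n \<in> sets M" for n unfolding B_def by measurable
  have B: "prob (B n) \<le> (\<Prod>i<n. R i)" for n
  proof -
    have "emeasure M (B n) = (\<integral>\<^sup>+\<omega>. indicator (B n) \<omega> \<partial>M)" by simp
    also have "\<dots> \<le> (\<integral>\<^sup>+\<omega>. (\<Prod>i<n. Z i \<omega>) \<partial>M)"
    proof (rule nn_integral_mono)
      fix \<omega> assume "\<omega> \<in> space M"
      have "(\<Prod>i<n. Z i \<omega>) = ennreal (\<Prod>i<n. Q i (X i \<omega>) powr s / \<rho> powr s)"
        unfolding Z_def by (intro prod_ennreal) auto
      also have "(\<Prod>i<n. Q i (X i \<omega>) powr s / \<rho> powr s) = ((\<Prod>i<n. Q i (X i \<omega>)) / \<rho> ^ n) powr s"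
        using \<rho>0 Q by (simp add: prod_dividef prod_powr_distrib powr_divide prod_nonneg powr_powr powr_realpow[symmetric] mult.commute)
      finally have e: "(\<Prod>i<n. Z i \<omega>) = ennreal (((\<Prod>i<n. Q i (X i \<omega>)) / \<rho> ^ n) powr s)" .
      show "indicator (B n) \<omega> \<le> (\<Prod>i<n. Z i \<omega>)"
      proof (cases "\<omega> \<in> B n")
        case True
        then have "1 \<le> (\<Prod>i<n. Q i (X i \<omega>)) / \<rho> ^ n" using \<rho>0 by (simp add: B_def)
        then have "1 \<le> ((\<Prod>i<n. Q i (X i \<omega>)) / \<rho> ^ n) powr s" using s by (intro ge_one_powr_ge_zero) auto
        then show ?thesis using True unfolding e by (simp add: ennreal_ge_1)
      qed simp
    qed
    also have "\<dots> = (\<Prod>i<n. ennreal (R i))"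
      by (subst indep_vars_nn_integral[OF _ indZ]) (auto simp: intZ)
    also have "\<dots> = ennreal (\<Prod>i<n. R i)"
      by (intro prod_ennreal R0)
    finally show ?thesis
      using R0 by (simp add: emeasure_eq_measure prod_nonneg)
  qed
  have "(\<lambda>i. R i) \<longlonglongrightarrow> (p powr (1 + s) + (1 - p) powr (1 + s)) / \<rho> powr s"
    unfolding R_def q_def using lim p \<rho>0
    by (intro tendsto_divide tendsto_add tendsto_powr tendsto_diff tendsto_const) auto
  moreover have "(p powr (1 + s) + (1 - p) powr (1 + s)) / \<rho> powr s < 1"
    using s \<rho>0 by simp
  then obtain \<kappa> where \<kappa>: "(p powr (1 + s) + (1 - p) powr (1 + s)) / \<rho> powr s < \<kappa>" "\<kappa> < 1"
    using dense by blast
  ultimately have "eventually (\<lambda>i. R i < \<kappa>) sequentially"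
    using order_tendstoD(2) by blast
  then obtain N where N: "\<And>i. N \<le> i \<Longrightarrow> R i < \<kappa>" by (auto simp: eventually_sequentially)
  have "summable (\<lambda>n. \<Prod>i<n. R i)"
  proof (rule summable_ratio_test[OF \<kappa>(2), of N])
    fix n assume "N \<le> n"
    then show "norm (\<Prod>i<Suc n. R i) \<le> \<kappa> * norm (\<Prod>i<n. R i)"
      using mult_right_mono[of "R n" \<kappa> "\<Prod>i<n. R i"] N[of n] R0
      by (simp add: abs_mult prod_nonneg mult.commute)
  qed
  then have "summable (\<lambda>n. prob (B n))"
    by (rule summable_comparison_test'[where N = 0]) (use B in auto)
  then have "AE \<omega> in M. eventually (\<lambda>n. \<omega> \<in> space M - B n) sequentially"
    by (intro borel_cantelli_AE1) (auto simp: emeasure_eq_measure)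
  then show ?thesis
  proof eventually_elim
    case (elim \<omega>)
    then show ?case by eventually_elim (auto simp: B_def cyl)
  qed
qed

section \<open>Periodic digit patterns\<close>

text \<open>Beyond the first period all terms of \<open>\<Sum>t. \<bar>d t - K\<bar> * x ^ d t\<close> have \<open>d t \<ge> K\<close>, so the rest
  of the series is a combination of \<open>\<Sum>j. x ^ (q * j)\<close> and \<open>\<Sum>j. j * x ^ (q * j)\<close>.\<close>

definition gap_sum_bound :: "(nat \<Rightarrow> nat) \<Rightarrow> nat \<Rightarrow> nat \<Rightarrow> real \<Rightarrow> real \<Rightarrow> real" where
  "gap_sum_bound d b q K x =
     (\<Sum>r<b. \<bar>real (d r) - K\<bar> * x ^ d r) +
     x ^ q * ((\<Sum>r<b. (real (d r) - K) * x ^ d r) / (1 - x ^ q) +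
       real q * (\<Sum>r<b. x ^ d r) / (1 - x ^ q)\<^sup>2)"

lemma periodic_gap_sum:
  fixes d :: "nat \<Rightarrow> nat" and x K :: real
  assumes per: "\<And>t. d (t + b) = d t + q" and bq: "0 < b" "0 < q" and x: "0 < x" "x < 1"
    and K: "\<And>r. r < b \<Longrightarrow> K \<le> real q + real (d r)"
  shows "summable (\<lambda>t. \<bar>real (d t) - K\<bar> * x ^ d t)"
    and "(\<Sum>t. \<bar>real (d t) - K\<bar> * x ^ d t) \<le> gap_sum_bound d b q K x"
proof -
  define f where "f t = \<bar>real (d t) - K\<bar> * x ^ d t" for t
  have f0: "0 \<le> f t" for t using x by (simp add: f_def)
  define y where "y = x ^ q"
  have y: "0 < y" "y < 1" using x bq by (auto simp: y_def power_less_one_iff)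
  define F where "F = (\<Sum>r<b. x ^ d r)"
  define G where "G = (\<Sum>r<b. (real (d r) - K) * x ^ d r)"
  \<comment> \<open>The sum over the \<open>j\<close>-th period. Absolute values matter only in
    \<open>h 0\<close>: from the next block on the gaps are at least \<open>q + d r\<close>, hence
    at least \<open>K\<close>.\<close>
  define h where "h j = (\<Sum>r<b. f (r + j * b))" for j
  have d: "d (r + j * b) = d r + j * q" for r j
  proof (induction j)
    case (Suc j)
    have "d (r + Suc j * b) = d ((r + j * b) + b)" by (simp add: algebra_simps)
    then show ?case using per Suc by simp
  qed simp
  have h: "h (Suc j) = y * (G * y ^ j + real q * F * (real (Suc j) * y ^ j))" for j
  proof -
    have "f (r + Suc j * b) = y * y ^ j * ((real (d r) - K) * x ^ d r) + y * y ^ j * (real q * real (Suc j)) * x ^ d r"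
      if "r < b" for r
    proof -
      have "K \<le> real (d r + Suc j * q)"
        by (rule order_trans[OF K[OF that]]) (simp add: distrib_right)
      then have "f (r + Suc j * b) = (real (d r + Suc j * q) - K) * x ^ (d r + Suc j * q)"
        unfolding f_def d by (simp add: abs_of_nonneg)
      also have "x ^ (d r + Suc j * q) = x ^ d r * (y * y ^ j)"
        unfolding y_def power_mult[symmetric] power_add[symmetric] by (simp add: mult.commute)
      finally show ?thesis by (simp add: algebra_simps)
    qed
    then have "h (Suc j) = (\<Sum>r<b. y * y ^ j * ((real (d r) - K) * x ^ d r) + y * y ^ j * (real q * real (Suc j)) * x ^ d r)"
      unfolding h_def by (intro sum.cong) auto
    also have "\<dots> = y * y ^ j * G + y * y ^ j * (real q * real (Suc j)) * F"
      by (simp add: sum.distrib sum_distrib_left F_def G_def)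
    finally show ?thesis by (simp add: algebra_simps)
  qed
  have "(\<lambda>j. y * (G * y ^ j + real q * F * (real (Suc j) * y ^ j))) sums
      (y * (G * (1 / (1 - y)) + real q * F * (1 / (1 - y)\<^sup>2)))"
    using y by (intro sums_mult sums_add geometric_sums geometric_deriv_sums) auto
  then have "h sums (h 0 + y * (G * (1 / (1 - y)) + real q * F * (1 / (1 - y)\<^sup>2)))"
    unfolding h[symmetric] by (subst add.commute) (rule sums_Suc)
  moreover have "h 0 + y * (G * (1 / (1 - y)) + real q * F * (1 / (1 - y)\<^sup>2)) = gap_sum_bound d b q K x"
    by (simp add: gap_sum_bound_def h_def f_def y_def F_def G_def)
  ultimately have hs: "h sums gap_sum_bound d b q K x" by simp
  have part: "(\<Sum>t<n. f t) \<le> gap_sum_bound d b q K x" for n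
  proof -
    have "(\<Sum>t<n. f t) \<le> (\<Sum>t<n * b. f t)"
      using f0 bq by (intro sum_mono2) auto
    also have "\<dots> = (\<Sum>j<n. h j)"
    proof -
      have "h j = sum f {j * b..<j * b + b}" for j
        using sum.shift_bounds_nat_ivl[of f 0 "j * b" b] by (simp add: h_def atLeast0LessThan add.commute)
      then show ?thesis using sum.nat_group[of f b n] by simp
    qed
    also have "\<dots> \<le> suminf h"
      using f0 by (intro sum_le_suminf sums_summable[OF hs]) (auto simp: h_def intro!: sum_nonneg)
    finally show ?thesis using sums_unique[OF hs] by simp
  qed
  have "summable f"
    by (rule summableI_nonneg_bounded[OF f0 part])
  then show "summable (\<lambda>t. \<bar>real (d t) - K\<bar> * x ^ d t)" "(\<Sum>t. \<bar>real (d t) - K\<bar> * x ^ d t) \<le> gap_sum_bound d b q K x"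
    using suminf_le_const[OF _ part] unfolding f_def by blast+
qed

text \<open>Enumerates the positions kept when \<open>c\<close> out of every \<open>b + c\<close>
  are deleted; the floor distributes the deletions evenly.\<close>

definition spread :: "nat \<Rightarrow> nat \<Rightarrow> nat \<Rightarrow> nat" where
  "spread c b i = i + (c * i) div b"

lemma spread_add_period: "0 < b \<Longrightarrow> spread c b (i + b * m) = spread c b i + (b + c) * m"
proof -
  assume "0 < b"
  then have "(c * (i + b * m)) div b = (c * i + b * (c * m)) div b" by (simp add: algebra_simps)
  then show ?thesis using \<open>0 < b\<close> by (simp add: spread_def algebra_simps)
qed

lemma strict_mono_spread: "strict_mono (spread c b)"
  unfolding strict_mono_Suc_iff
proof
  fix i
  have "(c * i) div b \<le> (c * Suc i) div b" by (intro div_le_mono) simp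
  then show "spread c b i < spread c b (Suc i)" by (simp add: spread_def)
qed

lemma spread_le: "0 < b \<Longrightarrow> b * spread c b i \<le> (b + c) * i"
  by (simp add: spread_def algebra_simps)

text \<open>By periodicity the gaps after \<open>n\<close> depend only on \<open>n mod b\<close>, so
  the transversality condition for all \<open>n\<close> reduces to \<open>b\<close> numerical
  inequalities.\<close>

lemma spread_gap_sum:
  fixes x K \<eta> :: real
  assumes b: "0 < b" and x: "0 < x" "x < 1" and K: "K \<le> real (b + c)"
    and num: "\<And>s. s < b \<Longrightarrow> gap_sum_bound (\<lambda>t. spread c b (s + 1 + t) - spread c b s) b (b + c) K x \<le> K - \<eta>"
  shows "summable (\<lambda>t. \<bar>real (spread c b (n + 1 + t) - spread c b n) - K\<bar> * x ^ (spread c b (n + 1 + t) - spread c b n))"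
    and "(\<Sum>t. \<bar>real (spread c b (n + 1 + t) - spread c b n) - K\<bar> * x ^ (spread c b (n + 1 + t) - spread c b n)) \<le> K - \<eta>"
proof -
  define s where "s = n mod b"
  define d where "d t = spread c b (s + 1 + t) - spread c b s" for t
  have n: "n = s + b * (n div b)" by (simp add: s_def)
  have "spread c b (n + 1 + t) - spread c b n = d t" for t
  proof -
    have "n + 1 + t = (s + 1 + t) + b * (n div b)" using n by simp
    then have "spread c b (n + 1 + t) = spread c b (s + 1 + t) + (b + c) * (n div b)"
      by (simp only: spread_add_period[OF b])
    moreover have "spread c b n = spread c b s + (b + c) * (n div b)"
      by (subst n) (simp only: spread_add_period[OF b])
    ultimately show ?thesis unfolding d_def by simp
  qed
  note d = this
  have per: "d (t + b) = d t + (b + c)" for t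
  proof -
    have "spread c b (s + 1 + t + b * 1) = spread c b (s + 1 + t) + (b + c) * 1"
      by (rule spread_add_period[OF b])
    moreover have "spread c b s \<le> spread c b (s + 1 + t)"
      by (intro strict_mono_leD[OF strict_mono_spread]) simp
    ultimately show ?thesis unfolding d_def by (simp add: add_ac)
  qed
  have "s < b" using b by (simp add: s_def)
  have "K \<le> real (b + c) + real (d r)" for r using K by simp
  note P = periodic_gap_sum[of d, OF per b _ x this]
  show "summable (\<lambda>t. \<bar>real (spread c b (n + 1 + t) - spread c b n) - K\<bar> * x ^ (spread c b (n + 1 + t) - spread c b n))"
    unfolding d by (rule P) (use b in auto)
  show "(\<Sum>t. \<bar>real (spread c b (n + 1 + t) - spread c b n) - K\<bar> * x ^ (spread c b (n + 1 + t) - spread c b n)) \<le> K - \<eta>"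
    unfolding d using num[OF \<open>s < b\<close>] unfolding d_def[symmetric]
    by (rule order_trans[rotated]) (rule P, use b in auto)
qed

section \<open>Rational verification of transversality for the four patterns\<close>

lemmas gap_sum_eval = gap_sum_bound_def spread_def lessThan_nat_numeral power2_eq_square power_divide

text \<open>The pattern without deletions is given period \<open>4\<close> so that
  \<open>K = 4\<close> does not exceed it. Here and in the next three estimates everything evaluates
  to rational numbers, with the common margin \<open>1 / 10\<close>.\<close>

lemma gap_sum_bound_0_4:
  assumes "s < 4"
  shows "gap_sum_bound (\<lambda>t. spread 0 4 (s + 1 + t) - spread 0 4 s) 4 (4 + 0) 4 (63 / 100) \<le> 4 - 1 / 10"
proof -
  consider "s = 0" | "s = 1" | "s = 2" | "s = 3" using assms by linarith
  then show ?thesis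
    by cases (simp_all add: gap_sum_eval)
qed

lemma gap_sum_bound_1_3:
  assumes "s < 3"
  shows "gap_sum_bound (\<lambda>t. spread 1 3 (s + 1 + t) - spread 1 3 s) 3 (3 + 1) 4 (67 / 100) \<le> 4 - 1 / 10"
proof -
  consider "s = 0" | "s = 1" | "s = 2" using assms by linarith
  then show ?thesis
    by cases (simp_all add: gap_sum_eval)
qed

lemma gap_sum_bound_2_4:
  assumes "s < 4"
  shows "gap_sum_bound (\<lambda>t. spread 2 4 (s + 1 + t) - spread 2 4 s) 4 (4 + 2) 6 (7 / 10) \<le> 6 - 1 / 10"
proof -
  consider "s = 0" | "s = 1" | "s = 2" | "s = 3" using assms by linarith
  then show ?thesis
    by cases (simp_all add: gap_sum_eval)
qed

lemma gap_sum_bound_2_3: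
  assumes "s < 3"
  shows "gap_sum_bound (\<lambda>t. spread 2 3 (s + 1 + t) - spread 2 3 s) 3 (3 + 2) 5 (91 / 125) \<le> 5 - 1 / 10"
proof -
  consider "s = 0" | "s = 1" | "s = 2" using assms by linarith
  then show ?thesis
    by cases (simp_all add: gap_sum_eval)
qed

section \<open>Discarding digits\<close>

text \<open>Given \<open>Z = z\<close>, the sum has a translate of the law of \<open>Y\<close>, and
  translates of Lebesgue null sets are null.\<close>

lemma (in prob_space) absolutely_continuous_add_indep:
  fixes Y Z :: "'a \<Rightarrow> real"
  assumes ind: "indep_var borel Y borel Z" and ac: "absolutely_continuous lborel (distr M borel Y)"
  shows "absolutely_continuous lborel (distr M borel (\<lambda>\<omega>. Y \<omega> + Z \<omega>))"
  unfolding absolutely_continuous_def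
proof
  have [measurable]: "Y \<in> borel_measurable M" "Z \<in> borel_measurable M"
    using indep_var_rv1[OF ind] indep_var_rv2[OF ind] by auto
  have joint: "distr M borel Y \<Otimes>\<^sub>M distr M borel Z = distr M (borel \<Otimes>\<^sub>M borel) (\<lambda>\<omega>. (Y \<omega>, Z \<omega>))"
    using ind unfolding indep_var_distribution_eq by blast
  interpret Y: prob_space "distr M borel Y" by (rule prob_space_distr) simp
  interpret Z: prob_space "distr M borel Z" by (rule prob_space_distr) simp
  interpret YZ: pair_sigma_finite "distr M borel Y" "distr M borel Z" by unfold_locales
  fix N :: "real set" assume N: "N \<in> null_sets lborel"
  then have [measurable]: "N \<in> sets borel" by auto
  have shift: "emeasure (distr M borel Y) ((\<lambda>y. y + z) -` N) = 0" for z
  proof -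
    have [measurable]: "(\<lambda>y. y + z) -` N \<in> sets borel"
      by (rule measurable_sets_borel[of "\<lambda>y. y + z" borel]) auto
    have "emeasure lborel ((\<lambda>y. y + z) -` N) = emeasure (distr lborel borel (\<lambda>y. z + y)) N"
      by (subst emeasure_distr) (auto simp: add.commute[of _ z])
    also have "\<dots> = 0" using N by (simp add: lborel_distr_plus null_sets_def)
    finally have "(\<lambda>y. y + z) -` N \<in> null_sets lborel" by (auto simp: null_sets_def)
    then show ?thesis using ac by (auto simp: absolutely_continuous_def)
  qed
  have "emeasure (distr M borel (\<lambda>\<omega>. Y \<omega> + Z \<omega>)) N =
      (\<integral>\<^sup>+x. indicator N x \<partial>distr M borel (\<lambda>\<omega>. Y \<omega> + Z \<omega>))"
    by simp
  also have "\<dots> = (\<integral>\<^sup>+\<omega>. indicator N (Y \<omega> + Z \<omega>) \<partial>M)"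
    by (subst nn_integral_distr) auto
  also have "\<dots> = (\<integral>\<^sup>+p. indicator N (fst p + snd p) \<partial>distr M (borel \<Otimes>\<^sub>M borel) (\<lambda>\<omega>. (Y \<omega>, Z \<omega>)))"
    by (subst nn_integral_distr) auto
  also have "\<dots> = (\<integral>\<^sup>+z. (\<integral>\<^sup>+y. indicator N (y + z) \<partial>distr M borel Y) \<partial>distr M borel Z)"
    unfolding joint[symmetric] by (subst YZ.nn_integral_snd[symmetric]) auto
  also have "\<dots> = (\<integral>\<^sup>+z. 0 \<partial>distr M borel Z)"
  proof (rule nn_integral_cong)
    fix z
    have "(\<integral>\<^sup>+y. indicator N (y + z) \<partial>distr M borel Y) = (\<integral>\<^sup>+y. indicator ((\<lambda>y. y + z) -` N) y \<partial>distr M borel Y)"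
      by (intro nn_integral_cong) (auto simp: indicator_def)
    also have "\<dots> = emeasure (distr M borel Y) ((\<lambda>y. y + z) -` N)"
      using measurable_sets_borel[of "\<lambda>y. y + z" borel N] by (intro nn_integral_indicator) auto
    finally show "(\<integral>\<^sup>+y. indicator N (y + z) \<partial>distr M borel Y) = 0" by (simp add: shift)
  qed
  finally show "N \<in> null_sets (distr M borel (\<lambda>\<omega>. Y \<omega> + Z \<omega>))"
    by (auto simp: null_sets_def)
qed

lemma (in prob_space) indep_vars_reindex:
  assumes ind: "indep_vars N X I" and g: "inj_on g J" "g ` J \<subseteq> I"
  shows "indep_vars (\<lambda>j. N (g j)) (\<lambda>j. X (g j)) J"
proof -
  have "disjoint_family_on (\<lambda>j. {g j}) J"
    using g(1) by (auto simp: disjoint_family_on_def inj_on_def)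
  then have "indep_vars (\<lambda>j. PiM {g j} N) (\<lambda>j \<omega>. restrict (\<lambda>i. X i \<omega>) {g j}) J"
    using g by (intro indep_vars_restrict[OF ind]) auto
  then have "indep_vars (\<lambda>j. N (g j)) (\<lambda>j \<omega>. restrict (\<lambda>i. X i \<omega>) {g j} (g j)) J"
    by (rule indep_vars_compose2) auto
  then show ?thesis by simp
qed

text \<open>The digits in \<open>range j\<close> and the remaining ones form disjoint blocks of
  independent variables, so the deleted part of the series is an independent summand.\<close>

lemma (in prob_space) absolutely_continuous_power_series_of_subsequence:
  fixes X :: "nat \<Rightarrow> 'a \<Rightarrow> real" and j :: "nat \<Rightarrow> nat" and l :: real
  assumes ind: "indep_vars (\<lambda>_. borel) X UNIV" and X01: "\<And>i \<omega>. X i \<omega> \<in> {0, 1}"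
    and j: "strict_mono j" and l: "0 < l" "l < 1"
    and ac: "absolutely_continuous lborel (distr M borel (\<lambda>\<omega>. \<Sum>i. X (j i) \<omega> * l ^ Suc (j i)))"
  shows "absolutely_continuous lborel (distr M borel (\<lambda>\<omega>. \<Sum>k. X k \<omega> * l ^ Suc k))"
proof -
  have [measurable]: "X i \<in> borel_measurable M" for i
    using ind by (auto simp: indep_vars_def)
  define Y where "Y \<omega> = (\<Sum>i. X (j i) \<omega> * l ^ Suc (j i))" for \<omega>
  define Z where "Z \<omega> = (\<Sum>k. (if k \<in> range j then 0 else X k \<omega> * l ^ Suc k))" for \<omega>
  have "indep_var (PiM (range j) (\<lambda>_. borel)) (\<lambda>\<omega>. restrict (\<lambda>i. X i \<omega>) (range j))
      (PiM (- range j) (\<lambda>_. borel)) (\<lambda>\<omega>. restrict (\<lambda>i. X i \<omega>) (- range j))"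
    by (rule indep_var_restrict[OF ind]) auto
  then have "indep_var borel ((\<lambda>f. \<Sum>i. f (j i) * l ^ Suc (j i)) \<circ> (\<lambda>\<omega>. restrict (\<lambda>i. X i \<omega>) (range j)))
      borel ((\<lambda>f. \<Sum>k. (if k \<in> range j then 0 else f k * l ^ Suc k)) \<circ> (\<lambda>\<omega>. restrict (\<lambda>i. X i \<omega>) (- range j)))"
  proof (rule indep_var_compose)
    show "(\<lambda>f. \<Sum>k. if k \<in> range j then 0 else f k * l ^ Suc k) \<in> borel_measurable (PiM (- range j) (\<lambda>_. borel))"
    proof (intro borel_measurable_suminf)
      fix k show "(\<lambda>f. if k \<in> range j then 0 else f k * l ^ Suc k) \<in> borel_measurable (PiM (- range j) (\<lambda>_. borel))"
        by (cases "k \<in> range j") auto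
    qed
  qed measurable
  also have "(\<lambda>f. \<Sum>i. f (j i) * l ^ Suc (j i)) \<circ> (\<lambda>\<omega>. restrict (\<lambda>i. X i \<omega>) (range j)) = Y"
    by (auto simp: Y_def fun_eq_iff)
  also have "(\<lambda>f. \<Sum>k. (if k \<in> range j then 0 else f k * l ^ Suc k)) \<circ> (\<lambda>\<omega>. restrict (\<lambda>i. X i \<omega>) (- range j)) = Z"
    by (auto simp: Z_def fun_eq_iff intro!: suminf_cong)
  finally have "indep_var borel Y borel Z" .
  then have "absolutely_continuous lborel (distr M borel (\<lambda>\<omega>. Y \<omega> + Z \<omega>))"
    using ac by (intro absolutely_continuous_add_indep) (auto simp: Y_def[abs_def])
  also have "(\<lambda>\<omega>. Y \<omega> + Z \<omega>) = (\<lambda>\<omega>. \<Sum>k. X k \<omega> * l ^ Suc k)"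
  proof
    fix \<omega>
    have b: "\<bar>X i \<omega>\<bar> \<le> 1" for i using X01[of i \<omega>] by auto
    have "summable (\<lambda>k. (if k \<in> range j then X k \<omega> else 0) * l ^ Suc k)"
      using b l by (intro summable_lacunary) (auto simp: strict_mono_Suc_iff)
    then have s1: "summable (\<lambda>k. if k \<in> range j then X k \<omega> * l ^ Suc k else 0)"
      by (rule summable_cong[THEN iffD1, rotated]) auto
    have "summable (\<lambda>k. (if k \<in> range j then 0 else X k \<omega>) * l ^ Suc k)"
      using b l by (intro summable_lacunary) (auto simp: strict_mono_Suc_iff)
    then have s2: "summable (\<lambda>k. if k \<in> range j then 0 else X k \<omega> * l ^ Suc k)"
      by (rule summable_cong[THEN iffD1, rotated]) auto
    have "(\<lambda>i. (\<lambda>k. if k \<in> range j then X k \<omega> * l ^ Suc k else 0) (j i)) sums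
        (\<Sum>k. if k \<in> range j then X k \<omega> * l ^ Suc k else 0)"
      by (subst sums_mono_reindex[OF j]) (auto intro: summable_sums s1)
    then have "Y \<omega> = (\<Sum>k. if k \<in> range j then X k \<omega> * l ^ Suc k else 0)"
      by (simp add: Y_def sums_iff)
    then have "Y \<omega> + Z \<omega> = (\<Sum>k. (if k \<in> range j then X k \<omega> * l ^ Suc k else 0) +
        (if k \<in> range j then 0 else X k \<omega> * l ^ Suc k))"
      unfolding Z_def using suminf_add[OF s1 s2] by simp
    also have "\<dots> = (\<Sum>k. X k \<omega> * l ^ Suc k)"
      by (intro suminf_cong) auto
    finally show "Y \<omega> + Z \<omega> = (\<Sum>k. X k \<omega> * l ^ Suc k)" .
  qed
  finally show ?thesis .
qed

section \<open>Biased Bernoulli convolutions\<close>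

text \<open>Only the exponents \<open>m * (spread c b i + 1)\<close> are kept, so the pattern acts
  on \<open>l ^ m\<close>. The assumption \<open>entropy\<close> says that \<open>u\<close> exceeds
  the threshold \<open>T powr (b / (b + c))\<close> belonging to the density of kept digits.\<close>

lemma (in prob_space) AE_absolutely_continuous_spread:
  fixes X :: "nat \<Rightarrow> 'a \<Rightarrow> real" and p u v K \<eta> :: real and b c m :: nat
  assumes ind: "indep_vars (\<lambda>_. borel) X UNIV" and X01: "\<And>i \<omega>. X i \<omega> \<in> {0, 1}"
    and lim: "(\<lambda>i. prob {\<omega> \<in> space M. X i \<omega> = 0}) \<longlonglongrightarrow> p" and p: "0 < p" "p < 1"
    and b: "0 < b" and m: "0 < m" and uv: "0 < u" "u \<le> v" "v < 1"
    and entropy: "(p powr p * (1 - p) powr (1 - p)) ^ b < u ^ (b + c)"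
    and K: "0 < K" "K \<le> real (b + c)" "0 < \<eta>"
    and num: "\<And>s. s < b \<Longrightarrow> gap_sum_bound (\<lambda>t. spread c b (s + 1 + t) - spread c b s) b (b + c) K v \<le> K - \<eta>"
  shows "AE l in lborel. 0 < l \<and> l ^ m \<in> {u..v} \<longrightarrow>
    absolutely_continuous lborel (distr M borel (\<lambda>\<omega>. \<Sum>k. X k \<omega> * l ^ Suc k))"
proof -
  define T where "T = p powr p * (1 - p) powr (1 - p)"
  have T0: "0 \<le> T" by (simp add: T_def)
  \<comment> \<open>\<open>R\<close> is \<open>u powr ((b + c) / b)\<close>, the decay of
    \<open>u ^ spread c b n\<close> per kept digit. A \<open>\<rho>\<close> strictly between
    \<open>T\<close> and \<open>R\<close> serves both the cylinder bound (\<open>T < \<rho>\<close>)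
    and the convergence of the weights (\<open>\<rho> < R\<close>).\<close>
  define R where "R = root b (u ^ (b + c))"
  have Rb: "R ^ b = u ^ (b + c)"
    unfolding R_def using b uv by (intro real_root_pow_pos2) auto
  have R0: "0 < R" unfolding R_def using b uv by simp
  have "T < R"
    using entropy R0 unfolding T_def[symmetric] Rb[symmetric] by (intro power_less_imp_less_base[of T b R]) auto
  then obtain \<rho> where \<rho>: "T < \<rho>" "\<rho> < R" using dense by blast
  have \<rho>0: "0 < \<rho>" using \<rho> T0 by linarith
  have "R ^ b < 1 ^ b" unfolding Rb using uv b by (simp add: power_less_one_iff)
  then have "R < 1" by (rule power_less_imp_less_base) simp
  define a where "a i = m * (spread c b i + 1)" for i
  \<comment> \<open>Digit \<open>X k\<close> carries the exponent \<open>Suc k\<close>; positivity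
    of \<open>a i\<close> makes the truncated subtraction exact.\<close>
  define j where "j i = a i - 1" for i
  have a_pos: "0 < a i" for i using m by (simp add: a_def)
  have a: "strict_mono a"
    using strict_monoD[OF strict_mono_spread] m by (auto simp: a_def strict_mono_def)
  have j: "strict_mono j"
    unfolding strict_mono_def j_def using strict_monoD[OF a] a_pos by (simp add: diff_less_mono Suc_leI)
  have Sj: "Suc (j i) = a i" for i using a_pos[of i] by (simp add: j_def)
  define u0 v0 where "u0 = root m u" and "v0 = root m v"
  have u0: "u0 ^ m = u" "0 < u0" and v0: "v0 ^ m = v" "u0 \<le> v0" "v0 < 1"
    using m uv by (auto simp: u0_def v0_def real_root_pow_pos2)
  have a_diff: "a (n + 1 + t) - a n = m * (spread c b (n + 1 + t) - spread c b n)" for n t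
    by (simp add: a_def diff_mult_distrib2)
  \<comment> \<open>Since \<open>v0 ^ m = v\<close>, stretching the gaps by \<open>m\<close>
    multiplies the gap sum by \<open>m\<close>, which is matched by scaling \<open>K\<close> and
    \<open>\<eta>\<close>.\<close>
  have gap: "\<bar>real (a (n + 1 + t) - a n) - m * K\<bar> * v0 ^ (a (n + 1 + t) - a n) =
      m * (\<bar>real (spread c b (n + 1 + t) - spread c b n) - K\<bar> * v ^ (spread c b (n + 1 + t) - spread c b n))" for n t
  proof -
    have "\<bar>real (m * d) - m * K\<bar> * v0 ^ (m * d) = m * (\<bar>real d - K\<bar> * v ^ d)" for d
      by (simp add: power_mult v0 abs_mult flip: right_diff_distrib)
    then show ?thesis unfolding a_diff .
  qed
  note gaps = spread_gap_sum[OF b _ uv(3) K(2) num]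
  have "AE l in lborel. l \<in> {u0..v0} \<longrightarrow>
    absolutely_continuous lborel (distr M borel (\<lambda>\<omega>. \<Sum>i. X (j i) \<omega> * l ^ a i))"
  proof (rule AE_absolutely_continuous_lacunary_series[where K = "m * K" and \<eta> = "m * \<eta>" and \<rho> = \<rho>])
    show "X (j i) \<in> borel_measurable M" for i
      using ind by (auto simp: indep_vars_def)
    show "summable (\<lambda>t. \<bar>real (a (n + 1 + t) - a n) - m * K\<bar> * v0 ^ (a (n + 1 + t) - a n))" for n
      unfolding gap using uv by (intro summable_mult gaps) auto
    show "(\<Sum>t. \<bar>real (a (n + 1 + t) - a n) - m * K\<bar> * v0 ^ (a (n + 1 + t) - a n)) \<le> m * K - m * \<eta>" for n
    proof -
      have "(\<Sum>t. \<bar>real (a (n + 1 + t) - a n) - m * K\<bar> * v0 ^ (a (n + 1 + t) - a n)) =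
        m * (\<Sum>t. \<bar>real (spread c b (n + 1 + t) - spread c b n) - K\<bar> * v ^ (spread c b (n + 1 + t) - spread c b n))"
        unfolding gap using uv by (intro suminf_mult gaps) auto
      also have "\<dots> \<le> m * (K - \<eta>)"
        using uv by (intro mult_left_mono gaps) auto
      finally show ?thesis by (simp add: algebra_simps)
    qed
    show "summable (\<lambda>n. \<rho> ^ n / u0 ^ a n)"
    proof (rule summable_comparison_test'[where N = 0])
      show "summable (\<lambda>n. (1 / u) * (\<rho> / R) ^ n)"
        using \<rho> \<rho>0 R0 by (intro summable_mult summable_geometric) auto
      fix n :: nat
      have "(R ^ n) ^ b = u ^ ((b + c) * n)"
        by (metis Rb power_mult mult.commute)
      also have "\<dots> \<le> u ^ (b * spread c b n)"
        using uv spread_le[OF b, of c n] by (intro power_decreasing) auto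
      also have "\<dots> = (u ^ spread c b n) ^ b" by (simp add: mult.commute flip: power_mult)
      finally have "R ^ n \<le> u ^ spread c b n"
        using b uv R0 by (subst (asm) power_mono_iff) auto
      have "u0 ^ a n = u * u ^ spread c b n"
        unfolding a_def power_mult u0(1) by simp
      have "\<rho> ^ n / (u * u ^ spread c b n) \<le> \<rho> ^ n / (u * R ^ n)"
        using \<open>R ^ n \<le> _\<close> \<rho>0 uv R0 by (intro divide_left_mono mult_left_mono mult_pos_pos) auto
      then show "norm (\<rho> ^ n / u0 ^ a n) \<le> (1 / u) * (\<rho> / R) ^ n"
        unfolding \<open>u0 ^ a n = _\<close> using \<rho>0 uv by (simp add: power_divide)
    qed
    show "AE \<omega> in M. eventually (\<lambda>n. prob {\<tau> \<in> space M. \<forall>i<n. X (j i) \<tau> = X (j i) \<omega>} \<le> \<rho> ^ n) sequentially"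
    proof (rule AE_eventually_cylinder_le)
      show "indep_vars (\<lambda>_. borel) (\<lambda>i. X (j i)) UNIV"
        by (rule indep_vars_reindex[OF ind]) (auto simp: strict_mono_imp_inj_on[OF j])
      show "(\<lambda>i. prob {\<omega> \<in> space M. X (j i) \<omega> = 0}) \<longlonglongrightarrow> p"
        using LIMSEQ_subseq_LIMSEQ[OF lim j] by (simp add: o_def)
      show "p powr p * (1 - p) powr (1 - p) < \<rho>" using \<rho> by (simp add: T_def)
    qed (use X01 p in auto)
  qed (use X01 a u0 v0 m K \<rho>0 \<rho> \<open>R < 1\<close> in auto)
  then show ?thesis
  proof (rule AE_mp, intro AE_I2 impI)
    fix l assume ac: "l \<in> {u0..v0} \<longrightarrow>
        absolutely_continuous lborel (distr M borel (\<lambda>\<omega>. \<Sum>i. X (j i) \<omega> * l ^ a i))"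
      and l: "0 < l \<and> l ^ m \<in> {u..v}"
    have "root m (l ^ m) = l" using l m by (simp add: real_root_power_cancel)
    then have "l \<in> {u0..v0}"
      using l m unfolding u0_def v0_def by (metis atLeastAtMost_iff real_root_le_mono)
    then have "absolutely_continuous lborel (distr M borel (\<lambda>\<omega>. \<Sum>i. X (j i) \<omega> * l ^ Suc (j i)))"
      using ac by (simp only: Sj)
    moreover have "l < 1" using \<open>l \<in> _\<close> v0 by auto
    ultimately show "absolutely_continuous lborel (distr M borel (\<lambda>\<omega>. \<Sum>k. X k \<omega> * l ^ Suc k))"
      using l by (intro absolutely_continuous_power_series_of_subsequence[OF ind X01 j]) auto
  qed
qed

text \<open>The logarithm of the threshold is symmetric about \<open>1 / 2\<close> and decreasing on
  \<open>[1/3, 1/2]\<close>, so the maximum is at \<open>p = 1 / 3\<close>, where the cube equals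
  \<open>1 / 3 * (2 / 3) ^ 2\<close>.\<close>

lemma entropy_threshold_le:
  fixes p :: real
  assumes "p \<in> {1/3..2/3}"
  shows "(p powr p * (1 - p) powr (1 - p)) ^ 3 \<le> 4 / 27"
proof -
  define f where "f x = x * ln x + (1 - x) * ln (1 - x)" for x :: real
  have f: "f x \<le> f (1 / 3)" if "1 / 3 \<le> x" "x \<le> 1 / 2" for x
  proof (rule DERIV_nonpos_imp_nonincreasing[OF that(1)])
    fix y assume y: "1 / 3 \<le> y" "y \<le> x"
    have "(f has_real_derivative (ln y - ln (1 - y))) (at y)"
    proof -
      have "0 < y" "0 < 1 - y" "y \<noteq> 1" using y that by auto
      then show ?thesis unfolding f_def by (auto intro!: derivative_eq_intros)
    qed
    moreover have "ln y \<le> ln (1 - y)" using y that by (subst ln_le_cancel_iff) auto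
    ultimately show "\<exists>z. (f has_real_derivative z) (at y) \<and> z \<le> 0" by fastforce
  qed
  have "f p \<le> f (1 / 3)"
  proof (cases "p \<le> 1 / 2")
    case True
    then show ?thesis using assms by (intro f) auto
  next
    case False
    have "f p = f (1 - p)" by (simp add: f_def)
    then show ?thesis using False assms f[of "1 - p"] by simp
  qed
  also have "f (1 / 3) = ln (4 / 27) / 3"
  proof -
    have "ln (4 / 27 :: real) = ln 4 - ln 27" by (simp add: ln_div)
    also have "\<dots> = 2 * ln 2 - 3 * ln 3"
      using ln_realpow[of 2 2] ln_realpow[of 3 3] by simp
    finally show ?thesis by (simp add: f_def ln_div field_simps)
  qed
  finally have "exp (3 * f p) \<le> exp (ln (4 / 27))" by (subst exp_le_cancel_iff) simp
  also have "exp (3 * f p) = (p powr p * (1 - p) powr (1 - p)) ^ 3"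
  proof -
    have "p powr p * (1 - p) powr (1 - p) = exp (f p)"
      using assms by (simp add: powr_def f_def exp_add)
    then show ?thesis by (simp add: exp_of_nat_mult[of 3, simplified])
  qed
  finally show ?thesis by simp
qed

text \<open>The four patterns delete no digit, every fourth, every third and two out of every five digits;
  the third is written with period \<open>4 + 2\<close> instead of \<open>2 + 1\<close> so that \<open>K = 6\<close> does not exceed the period.\<close>

lemma (in prob_space) AE_absolutely_continuous_biased_series:
  fixes X :: "nat \<Rightarrow> 'a \<Rightarrow> real" and p :: real
  assumes ind: "indep_vars (\<lambda>_. borel) X UNIV" and X01: "\<And>i \<omega>. X i \<omega> \<in> {0, 1}"
    and lim: "(\<lambda>i. prob {\<omega> \<in> space M. X i \<omega> = 0}) \<longlonglongrightarrow> p" and p: "p \<in> {1/3..2/3}"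
  shows "AE l in lborel. l \<in> {p powr p * (1 - p) powr (1 - p)..<1} \<longrightarrow>
    absolutely_continuous lborel (distr M borel (\<lambda>\<omega>. \<Sum>k. X k \<omega> * l ^ Suc k))"
proof -
  define T where "T = p powr p * (1 - p) powr (1 - p)"
  have p01: "0 < p" "p < 1" using p by auto
  have T0: "0 < T" unfolding T_def using p01 by simp
  have T3: "T ^ 3 \<le> 4 / 27" unfolding T_def by (rule entropy_threshold_le[OF p])
  define A where "A l \<longleftrightarrow> absolutely_continuous lborel (distr M borel (\<lambda>\<omega>. \<Sum>k. X k \<omega> * l ^ Suc k))" for l :: real
  note spread = AE_absolutely_continuous_spread[OF ind X01 lim p01, folded A_def T_def]
  \<comment> \<open>This pattern needs a left end strictly above \<open>T\<close>. The ends
    \<open>u i\<close> decrease to \<open>T\<close>, so countably many intervals cover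
    \<open>(T, 63 / 100]\<close>; the cap keeps them nonempty.\<close>
  define u where "u i = min (63 / 100) (T + 1 / Suc i)" for i
  have "AE l in lborel. 0 < l \<and> l ^ (2 ^ n) \<in> {u i..63 / 100} \<longrightarrow> A l" for n i
  proof (rule spread[where b = 4 and c = 0 and K = 4 and \<eta> = "1 / 10"])
    have "T < 63 / 100"
    proof (rule power_less_imp_less_base)
      show "T ^ 3 < (63 / 100) ^ 3" using T3 by (simp add: power_divide)
    qed simp
    then have "T < u i" by (simp add: u_def)
    then show "T ^ 4 < u i ^ (4 + 0)" using T0 by (auto intro!: power_strict_mono)
    show "0 < u i" using \<open>T < u i\<close> T0 by linarith
    show "u i \<le> 63 / 100" unfolding u_def by (rule min.cobounded1)
  qed (use gap_sum_bound_0_4 in auto)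
  \<comment> \<open>Each further interval starts where the previous one ends; its left end must
    clear the threshold of its own pattern, here because
    \<open>(63 / 100) ^ 4 > 4 / 27\<close>.\<close>
  moreover have "AE l in lborel. 0 < l \<and> l ^ (2 ^ n) \<in> {63 / 100..67 / 100} \<longrightarrow> A l" for n
  proof (rule spread[where b = 3 and c = 1 and K = 4 and \<eta> = "1 / 10"])
    show "T ^ 3 < (63 / 100) ^ (3 + 1)" using T3 by (simp add: power_divide)
  qed (use gap_sum_bound_1_3 in auto)
  moreover have "AE l in lborel. 0 < l \<and> l ^ (2 ^ n) \<in> {67 / 100..7 / 10} \<longrightarrow> A l" for n
  proof (rule spread[where b = 4 and c = 2 and K = 6 and \<eta> = "1 / 10"])
    \<comment> \<open>The available bound is on \<open>T ^ 3\<close>, so both sides are cubed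
      first.\<close>
    have "(T ^ 4) ^ 3 = (T ^ 3) ^ 4" by (simp flip: power_mult)
    also have "\<dots> \<le> (4 / 27) ^ 4" using T3 T0 by (intro power_mono) auto
    also have "\<dots> < ((67 / 100) ^ (4 + 2)) ^ 3" by (simp add: power_divide)
    finally show "T ^ 4 < (67 / 100) ^ (4 + 2)" by (rule power_less_imp_less_base) simp
  qed (use gap_sum_bound_2_4 in auto)
  moreover have "AE l in lborel. 0 < l \<and> l ^ (2 ^ n) \<in> {7 / 10..91 / 125} \<longrightarrow> A l" for n
  proof (rule spread[where b = 3 and c = 2 and K = 5 and \<eta> = "1 / 10"])
    show "T ^ 3 < (7 / 10) ^ (3 + 2)" using T3 by (simp add: power_divide)
  qed (use gap_sum_bound_2_3 in auto)
  ultimately have "AE l in lborel. \<forall>n. (\<forall>i. 0 < l \<and> l ^ (2 ^ n) \<in> {u i..63 / 100} \<longrightarrow> A l) \<and>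
      (0 < l \<and> l ^ (2 ^ n) \<in> {63 / 100..67 / 100} \<longrightarrow> A l) \<and>
      (0 < l \<and> l ^ (2 ^ n) \<in> {67 / 100..7 / 10} \<longrightarrow> A l) \<and>
      (0 < l \<and> l ^ (2 ^ n) \<in> {7 / 10..91 / 125} \<longrightarrow> A l)"
    unfolding AE_all_countable AE_conj_iff by blast
  moreover have "AE l in lborel. l \<noteq> T" by (rule AE_lborel_singleton)
  ultimately have "AE l in lborel. l \<in> {T..<1} \<longrightarrow> A l"
  proof eventually_elim
    case (elim l)
    show ?case
    proof
      assume "l \<in> {T..<1}"
      then have l: "T < l" "l < 1" "0 < l" using elim T0 by auto
      obtain k where k: "l ^ k < T" using real_arch_pow_inv[OF T0 l(2)] by blast
      \<comment> \<open>Squaring is repeated until just before the value drops to \<open>T\<close>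
        or below; thus \<open>T < y\<close> and \<open>y ^ 2 \<le> T\<close> for
        \<open>y = l ^ 2 ^ n\<close>.\<close>
      define n where "n = (LEAST n. l ^ (2 ^ Suc n) \<le> T)"
      have "l ^ (2 ^ Suc k) \<le> l ^ k"
        using l less_exp[of "Suc k"] by (intro power_decreasing) auto
      then have "l ^ (2 ^ Suc k) \<le> T" using k by linarith
      then have n: "l ^ (2 ^ Suc n) \<le> T" unfolding n_def by (rule LeastI)
      define y where "y = l ^ (2 ^ n)"
      have "T < y"
      proof (cases n)
        case 0
        then show ?thesis using l by (simp add: y_def)
      next
        case (Suc i)
        then have "\<not> l ^ (2 ^ Suc i) \<le> T" using not_less_Least[of i "\<lambda>n. l ^ (2 ^ Suc n) \<le> T"] n_def by auto
        then show ?thesis using Suc by (simp add: y_def)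
      qed
      have "y ^ 2 \<le> T" using n by (simp add: y_def mult.commute flip: power_mult)
      \<comment> \<open>The end \<open>91 / 125\<close> lies just above
        \<open>(4 / 27) powr (1 / 6)\<close>, the largest possible value of
        \<open>sqrt T\<close>.\<close>
      have "y ^ 6 = (y ^ 2) ^ 3" by (simp flip: power_mult)
      also have "\<dots> \<le> T ^ 3" using \<open>y ^ 2 \<le> T\<close> by (intro power_mono) auto
      also have "\<dots> < (91 / 125) ^ 6" using T3 by (simp add: power_divide)
      finally have "y < 91 / 125" by (rule power_less_imp_less_base) simp
      then consider "y \<le> 63 / 100" | "y \<in> {63 / 100..67 / 100}" | "y \<in> {67 / 100..7 / 10}" | "y \<in> {7 / 10..91 / 125}"
        by fastforce
      then show "A l"
      proof cases
        case 1
        obtain i where "1 / Suc i < y - T" using nat_approx_posE[of "y - T"] \<open>T < y\<close> by auto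
        then have "y \<in> {u i..63 / 100}" using 1 by (auto simp: u_def)
        then show ?thesis using elim l unfolding y_def by blast
      next
        case 2
        then show ?thesis using elim l unfolding y_def by blast
      next
        case 3
        then show ?thesis using elim l unfolding y_def by blast
      next
        case 4
        then show ?thesis using elim l unfolding y_def by blast
      qed
    qed
  qed
  then show ?thesis by (simp only: A_def T_def)
qed

section \<open>Passage from almost surely binary variables to exactly binary digits\<close>

theorem theorem8:
  fixes M :: "'a measure" and \<psi> :: "nat \<Rightarrow> 'a \<Rightarrow> real"
    and p0 p1 :: "nat \<Rightarrow> real" and p :: real
  assumes "prob_space M"
    and "\<And>k. k \<ge> 1 \<Longrightarrow> p0 k \<ge> 0"
    and "\<And>k. k \<ge> 1 \<Longrightarrow> p1 k \<ge> 0"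
    and "\<And>k. k \<ge> 1 \<Longrightarrow> p0 k + p1 k = 1"
    and "prob_space.indep_vars M (\<lambda>_. borel) \<psi> {1..}"
    and "\<And>k. k \<ge> 1 \<Longrightarrow> measure M {\<omega> \<in> space M. \<psi> k \<omega> = 0} = p0 k"
    and "\<And>k. k \<ge> 1 \<Longrightarrow> measure M {\<omega> \<in> space M. \<psi> k \<omega> = 1} = p1 k"
    and "p \<in> {1/3..2/3}"
    and "summable (\<lambda>k. (p - p0 (Suc k))\<^sup>2)"
  shows "AE l in lborel. l \<in> {p powr p * (1 - p) powr (1 - p)..<1} \<longrightarrow>
           has_abs_cont_distribution M (random_power_series \<psi> l)"
proof -
  interpret prob_space M by fact
  have [measurable]: "\<psi> (Suc k) \<in> borel_measurable M" for k
    using assms(5) by (auto simp: indep_vars_def)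
  \<comment> \<open>A version of \<open>\<psi>\<close> with values in \<open>{0, 1}\<close>
    everywhere, as the convergence arguments require; index \<open>0\<close> of \<open>X\<close> is
    index \<open>1\<close> of \<open>\<psi>\<close>.\<close>
  define X where "X k \<omega> = (if \<psi> (Suc k) \<omega> = 1 then 1 else 0 :: real)" for k \<omega>
  have [measurable]: "X k \<in> borel_measurable M" for k unfolding X_def by measurable
  have "indep_vars (\<lambda>_. borel) (\<lambda>k. \<psi> (Suc k)) UNIV"
    by (rule indep_vars_reindex[OF assms(5)]) auto
  then have ind: "indep_vars (\<lambda>_. borel) X UNIV"
    unfolding X_def by (rule indep_vars_compose2) auto
  have "prob {\<omega> \<in> space M. X k \<omega> = 0} = p0 (Suc k)" for k
  proof -
    have "{\<omega> \<in> space M. X k \<omega> = 0} = space M - {\<omega> \<in> space M. \<psi> (Suc k) \<omega> = 1}"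
      by (auto simp: X_def)
    then show ?thesis
      using assms(4,7)[of "Suc k"] by (simp add: prob_compl)
  qed
  moreover have "(\<lambda>k. p0 (Suc k)) \<longlonglongrightarrow> p"
  proof -
    have "(\<lambda>k. \<bar>p - p0 (Suc k)\<bar>) \<longlonglongrightarrow> 0"
      using tendsto_real_sqrt[OF summable_LIMSEQ_zero[OF assms(9)]] by simp
    then have "(\<lambda>k. p - (p - p0 (Suc k))) \<longlonglongrightarrow> p - 0"
      by (intro tendsto_diff tendsto_const) (simp add: tendsto_rabs_zero_iff)
    then show ?thesis by simp
  qed
  ultimately have lim: "(\<lambda>k. prob {\<omega> \<in> space M. X k \<omega> = 0}) \<longlonglongrightarrow> p" by simp
  have "AE \<omega> in M. \<psi> (Suc k) \<omega> = X k \<omega>" for k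
  proof -
    have "prob ({\<omega> \<in> space M. \<psi> (Suc k) \<omega> = 0} \<union> {\<omega> \<in> space M. \<psi> (Suc k) \<omega> = 1}) = 1"
      using assms(4,6,7)[of "Suc k"] by (subst finite_measure_Union) auto
    then have "AE \<omega> in M. \<omega> \<in> {\<omega> \<in> space M. \<psi> (Suc k) \<omega> = 0} \<union> {\<omega> \<in> space M. \<psi> (Suc k) \<omega> = 1}"
      by (subst (asm) prob_eq_1) auto
    then show ?thesis by eventually_elim (auto simp: X_def)
  qed
  then have "AE \<omega> in M. \<forall>k. \<psi> (Suc k) \<omega> = X k \<omega>" by (simp add: AE_all_countable)
  \<comment> \<open>Off one null set, independent of \<open>l\<close>, the two series agree term by
    term, so their \<open>suminf\<close> values agree even where a series diverges.\<close>
  then have eq: "distr M borel (random_power_series \<psi> l) = distr M borel (\<lambda>\<omega>. \<Sum>k. X k \<omega> * l ^ Suc k)" for l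
    unfolding random_power_series_def by (intro distr_cong_AE) (auto elim!: eventually_mono)
  have meas: "random_power_series \<psi> l \<in> borel_measurable M" for l
    unfolding random_power_series_def[abs_def] by measurable
  have "AE l in lborel. l \<in> {p powr p * (1 - p) powr (1 - p)..<1} \<longrightarrow>
    absolutely_continuous lborel (distr M borel (\<lambda>\<omega>. \<Sum>k. X k \<omega> * l ^ Suc k))"
    by (rule AE_absolutely_continuous_biased_series[OF ind _ lim assms(8)]) (auto simp: X_def)
  then show ?thesis
    unfolding has_abs_cont_distribution_def eq
    by eventually_elim (simp add: meas)
qed

end
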